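(* Let $\Delta$ be a division ring of characteristic zero. Suppose that for every $n \in \mathbb{N}$ every semigroup of unipotent matrices in $M_n(\Delta)$ is triangularizable. Then for every $n \in \mathbb{N}$, every semigroup in $M_n(\Delta)$ all of whose members are of the form $cI + N$, where $c$ is in the center of $\Delta$ and $N \in M_n(\Delta)$ is nilpotent, is triangularizable.
   Context: $M_n(\Delta)$ is the ring of all $n \times n$ matrices over $\Delta$, whose members are viewed as linear transformations acting on the left of $\Delta^n$, the right vector space over $\Delta$ of $n \times 1$ column vectors. A semigroup in $M_n(\Delta)$ is a set of matrices closed under multiplication. A matrix is unipotent if it is of the form $I + N$, where $I$ is the identity matrix and $N$ is nilpotent. A collection $\mathcal{C} \subseteq M_n(\Delta)$ is triangularizable if there are subspaces $\{0\} = \mathcal{V}_0 \subseteq \mathcal{V}_1 \subseteq \cdots \subseteq \mathcal{V}_n = \Delta^n$ such that $\dim \mathcal{V}_j = j$ and each $\mathcal{V}_j$ is invariant under every member of $\mathcal{C}$ (the same chain for all members). *)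

theory Defs
  imports "Jordan_Normal_Form.Matrix"
begin

text \<open>
  The scalars form an arbitrary, possibly noncommutative, ring or division ring. Column vectors
  of length \<open>n\<close> are regarded as a \<^emph>\<open>right\<close> module, so scalars multiply coordinates on the right,
  whereas the library operations \<open>smult_vec\<close> and \<open>smult_mat\<close> multiply on the left. Matrices act on
  column vectors from the left by \<open>mult_mat_vec\<close>, whose \<open>i\<close>-th coordinate is the sum
  of the products \<open>A $$ (i, j) * v $ j\<close>, in this order.
\<close>

definition rsmult_vec :: "'a::times vec \<Rightarrow> 'a \<Rightarrow> 'a vec" where
  "rsmult_vec v c = map_vec (\<lambda>x. x * c) v"

definition right_subspace :: "nat \<Rightarrow> 'a::ring_1 vec set \<Rightarrow> bool" where
  "right_subspace n V \<longleftrightarrow>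
     V \<subseteq> carrier_vec n \<and> 0\<^sub>v n \<in> V \<and>
     (\<forall>v\<in>V. \<forall>w\<in>V. v + w \<in> V) \<and>
     (\<forall>v\<in>V. \<forall>c. rsmult_vec v c \<in> V)"

definition right_lincomb :: "nat \<Rightarrow> nat \<Rightarrow> (nat \<Rightarrow> 'a::ring_1 vec) \<Rightarrow> (nat \<Rightarrow> 'a) \<Rightarrow> 'a vec" where
  "right_lincomb n d b c = finsum_vec TYPE('a) n (\<lambda>k. rsmult_vec (b k) (c k)) {..<d}"

definition right_basis :: "nat \<Rightarrow> 'a::ring_1 vec set \<Rightarrow> nat \<Rightarrow> (nat \<Rightarrow> 'a vec) \<Rightarrow> bool" where
  "right_basis n V d b \<longleftrightarrow>
     (\<forall>k<d. b k \<in> V) \<and>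
     (\<forall>c. right_lincomb n d b c = 0\<^sub>v n \<longrightarrow> (\<forall>k<d. c k = 0)) \<and>
     (\<forall>v\<in>V. \<exists>c. v = right_lincomb n d b c)"

text \<open>
  Dimension is rendered as a relation: over a division ring any two bases of a subspace have the
  same number of elements, so at most one \<open>d\<close> satisfies it.
\<close>

definition has_right_dim :: "nat \<Rightarrow> 'a::ring_1 vec set \<Rightarrow> nat \<Rightarrow> bool" where
  "has_right_dim n V d \<longleftrightarrow> (\<exists>b. right_basis n V d b)"

definition ring_center :: "'a::times set" where
  "ring_center = {c. \<forall>x. c * x = x * c}"

definition nilpotent_mat :: "nat \<Rightarrow> 'a::ring_1 mat \<Rightarrow> bool" where
  "nilpotent_mat n N \<longleftrightarrow> N \<in> carrier_mat n n \<and> (\<exists>k. N ^\<^sub>m k = 0\<^sub>m n n)"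

definition unipotent_mat :: "nat \<Rightarrow> 'a::ring_1 mat \<Rightarrow> bool" where
  "unipotent_mat n A \<longleftrightarrow> (\<exists>N. nilpotent_mat n N \<and> A = 1\<^sub>m n + N)"

definition central_plus_nilpotent_mat :: "nat \<Rightarrow> 'a::ring_1 mat \<Rightarrow> bool" where
  "central_plus_nilpotent_mat n A \<longleftrightarrow>
     (\<exists>c\<in>ring_center. \<exists>N. nilpotent_mat n N \<and> A = c \<cdot>\<^sub>m 1\<^sub>m n + N)"

definition mat_semigroup :: "nat \<Rightarrow> 'a::ring_1 mat set \<Rightarrow> bool" where
  "mat_semigroup n S \<longleftrightarrow> S \<subseteq> carrier_mat n n \<and> (\<forall>A\<in>S. \<forall>B\<in>S. A * B \<in> S)"

definition triangularizable :: "nat \<Rightarrow> 'a::ring_1 mat set \<Rightarrow> bool" where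
  "triangularizable n S \<longleftrightarrow>
     (\<exists>V :: nat \<Rightarrow> 'a vec set.
        V 0 = {0\<^sub>v n} \<and> V n = carrier_vec n \<and>
        (\<forall>j<n. V j \<subseteq> V (Suc j)) \<and>
        (\<forall>j\<le>n. right_subspace n (V j) \<and> has_right_dim n (V j) j \<and>
               (\<forall>A\<in>S. \<forall>v\<in>V j. A *\<^sub>v v \<in> V j)))"

end

theory Submission
  imports Defs "HOL-Computational_Algebra.Field_as_Ring" "Jordan_Normal_Form.Determinant"
begin

text \<open>
  By induction on \<open>n\<close> it suffices to find a proper nonzero invariant subspace when \<open>n \<ge> 2\<close>. If the
  semigroup contains a nonzero nilpotent element, one of minimal range provides it. Otherwise every
  nonzero element is \<open>c * U\<close> with \<open>c \<noteq> 0\<close> central and \<open>U\<close> unipotent, and the point is that the matrices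
  \<open>U\<close> again form a semigroup, so that the hypothesis yields an invariant line.

  For unipotent \<open>A\<close> and \<open>B\<close> write \<open>P k = A^k * B = e k * (I + nilpotent)\<close> with \<open>e k\<close> in the center \<open>F\<close>.
  In characteristic zero \<open>P k\<close> is a polynomial in \<open>k\<close>. Applying an \<open>F\<close>-linear form to the relation
  \<open>(P k - e k)^m = 0\<close> with \<open>m\<close> minimal shows that \<open>e k = p k / q k\<close> for coprime polynomials \<open>p\<close> and \<open>q\<close>
  over \<open>F\<close>, and that \<open>q\<close> divides \<open>p^n\<close>. The inverse of \<open>P k\<close> is polynomial in \<open>k\<close> as well, so \<open>p\<close>
  divides \<open>q^n\<close>. Hence \<open>e\<close> is constant, and \<open>e 1 = e 0 = 1\<close>.
\<close>

section \<open>The center as a field\<close>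

text \<open>Over a commutative field, \<open>e k\<close> would be the trace of \<open>P k\<close>
  divided by \<open>n\<close>, hence a polynomial in \<open>k\<close> at once. Over a noncommutative
  division ring a nilpotent matrix can have nonzero trace, and determinants make sense only modulo
  commutators, so neither controls \<open>e k\<close>. The substitute is a linear form over the
  center, applied to single entries of powers: the nilpotency relation has central coefficients, so
  it survives as a linear recurrence over a commutative field, from which Cramer's rule extracts
  \<open>e k\<close>. Minimality of \<open>m\<close> keeps the determinant of that system from
  vanishing identically. The price is that \<open>e\<close> is at first only rational in
  \<open>k\<close>; the two divisibilities remove its poles and its zeros. The induction on
  \<open>n\<close> runs on diagonal blocks of conjugated matrices rather than on subspaces and
  quotients, so every object stays a concrete matrix.\<close>

typedef (overloaded) 'a center = "ring_center :: 'a::division_ring set"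
  morphisms cval Center
  by (auto simp: ring_center_def intro!: exI[of _ 0])

setup_lifting type_definition_center

text \<open>As a type of class \<open>field\<close>, the center admits the library's polynomials,
  determinants and vector spaces, which need commuting scalars.\<close>

instantiation center :: (division_ring) field
begin

lift_definition zero_center :: "'a center" is 0 by (simp add: ring_center_def)
lift_definition one_center :: "'a center" is 1 by (simp add: ring_center_def)
lift_definition plus_center :: "'a center \<Rightarrow> 'a center \<Rightarrow> 'a center" is "(+)"
  by (simp add: ring_center_def distrib_left distrib_right)
lift_definition minus_center :: "'a center \<Rightarrow> 'a center \<Rightarrow> 'a center" is "(-)"
  by (simp add: ring_center_def left_diff_distrib right_diff_distrib)
lift_definition uminus_center :: "'a center \<Rightarrow> 'a center" is uminus
  by (simp add: ring_center_def)
lift_definition times_center :: "'a center \<Rightarrow> 'a center \<Rightarrow> 'a center" is "(*)"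
proof (unfold ring_center_def mem_Collect_eq, rule allI)
  fix a b x :: 'a
  assume a: "\<forall>x. a * x = x * a" and b: "\<forall>x. b * x = x * b"
  show "a * b * x = x * (a * b)"
    using a[rule_format, of x] b[rule_format, of x] by (metis mult.assoc)
qed
lift_definition inverse_center :: "'a center \<Rightarrow> 'a center" is inverse
proof (unfold ring_center_def mem_Collect_eq, rule allI)
  fix c x :: 'a
  assume c: "\<forall>x. c * x = x * c"
  show "inverse c * x = x * inverse c"
  proof (cases "c = 0")
    case False
    have "inverse c * x = inverse c * (x * c) * inverse c"
      using False by (simp add: mult.assoc)
    also have "\<dots> = inverse c * (c * x) * inverse c"
      using c by simp
    also have "\<dots> = x * inverse c"
      using False by (simp add: mult.assoc[symmetric])
    finally show ?thesis .
  qed simp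
qed
definition divide_center :: "'a center \<Rightarrow> 'a center \<Rightarrow> 'a center" where
  "divide_center x y = x * inverse y"

instance
proof
  fix a b c :: "'a center"
  show "a * b * c = a * (b * c)" by transfer (simp add: mult.assoc)
  show "a * b = b * a" by transfer (unfold ring_center_def, blast)
  show "1 * a = a" by transfer simp
  show "a + b + c = a + (b + c)" by transfer (simp add: add.assoc)
  show "a + b = b + a" by transfer (simp add: add.commute)
  show "0 + a = a" by transfer simp
  show "- a + a = 0" by transfer simp
  show "a - b = a + - b" by transfer simp
  show "(a + b) * c = a * c + b * c" by transfer (simp add: distrib_right)
  show "(0 :: 'a center) \<noteq> 1" by transfer simp
  show "a \<noteq> 0 \<Longrightarrow> inverse a * a = 1" by transfer simp
  show "a div b = a * inverse b" by (simp add: divide_center_def)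
  show "inverse (0 :: 'a center) = 0" by transfer simp
qed

end

lemma cval_simps [simp]:
  "cval 0 = 0" "cval 1 = 1" "cval (x + y) = cval x + cval y" "cval (x - y) = cval x - cval y"
  "cval (- x) = - cval x" "cval (x * y) = cval x * cval y" "cval (inverse x) = inverse (cval x)"
  by (transfer; simp)+

lemma cval_commute: "cval c * x = x * cval c"
  by transfer (unfold ring_center_def, blast)

lemma cval_eq_0_iff [simp]: "cval c = 0 \<longleftrightarrow> c = 0"
  by transfer simp

lemma cval_of_nat [simp]: "cval (of_nat n) = of_nat n"
  by (induction n) auto

lemma cval_power [simp]: "cval (x ^ n) = cval x ^ n"
  by (induction n) auto

instance center :: ("{division_ring, ring_char_0}") field_char_0
proof
  show "inj (of_nat :: nat \<Rightarrow> 'a center)"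
    by (rule injI) (metis cval_of_nat of_nat_eq_iff)
qed

text \<open>The trivial Euclidean structure of a field. With the instances below it yields
  \<open>field_gcd\<close>, and so the gcd of polynomials that reduces the fraction in
  \<open>eigenvalue_constant\<close>.\<close>

instantiation center ::
  (division_ring) "{unique_euclidean_ring, normalization_euclidean_semiring, normalization_semidom_multiplicative}"
begin

definition [simp]: "normalize_center = (normalize_field :: 'a center \<Rightarrow> _)"
definition [simp]: "unit_factor_center = (unit_factor_field :: 'a center \<Rightarrow> _)"
definition [simp]: "modulo_center = (mod_field :: 'a center \<Rightarrow> _)"
definition [simp]: "euclidean_size_center = (euclidean_size_field :: 'a center \<Rightarrow> _)"
definition [simp]: "division_segment (x :: 'a center) = 1"

instance
  by standard
    (simp_all add: dvd_field_iff field_split_simps split: if_splits)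

end

instantiation center :: (division_ring) euclidean_ring_gcd
begin

definition gcd_center :: "'a center \<Rightarrow> 'a center \<Rightarrow> 'a center" where
  "gcd_center = Euclidean_Algorithm.gcd"
definition lcm_center :: "'a center \<Rightarrow> 'a center \<Rightarrow> 'a center" where
  "lcm_center = Euclidean_Algorithm.lcm"
definition Gcd_center :: "'a center set \<Rightarrow> 'a center" where
  "Gcd_center = Euclidean_Algorithm.Gcd"
definition Lcm_center :: "'a center set \<Rightarrow> 'a center" where
  "Lcm_center = Euclidean_Algorithm.Lcm"

instance
  by standard (simp_all add: gcd_center_def lcm_center_def Gcd_center_def Lcm_center_def)

end

instance center :: (division_ring) field_gcd ..

section \<open>Linear forms over the center\<close>

definition center_linear :: "('a::division_ring \<Rightarrow> 'a center) \<Rightarrow> bool" where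
  "center_linear \<psi> \<longleftrightarrow> (\<forall>x y. \<psi> (x + y) = \<psi> x + \<psi> y) \<and> (\<forall>c x. \<psi> (cval c * x) = c * \<psi> x)"

text \<open>The division ring is a vector space over its center, possibly of infinite dimension, and
  the independent set \<open>{x}\<close> extends to a basis. Such forms carry a nonzero matrix entry
  to a nonzero element of a commutative field.\<close>

lemma center_linear_exists:
  fixes x :: "'a::division_ring"
  assumes "x \<noteq> 0"
  shows "\<exists>\<psi>. center_linear \<psi> \<and> \<psi> x = 1"
proof -
  interpret vector_space_pair "\<lambda>c (x::'a). cval c * x" "(*) :: 'a center \<Rightarrow> _"
    by unfold_locales (simp_all add: algebra_simps)
  have "vs1.independent {x}"
    using assms by (simp add: vs1.dependent_single)
  then obtain g where "Vector_Spaces.linear (\<lambda>c x. cval c * x) (*) g" "g x = 1"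
    using linear_independent_extend[of "{x}" "\<lambda>_. 1"] by auto
  then show ?thesis
    by (auto simp: center_linear_def Vector_Spaces.linear_iff)
qed

lemma center_linear_zero [simp]: "center_linear \<psi> \<Longrightarrow> \<psi> 0 = 0"
  unfolding center_linear_def by (metis add_cancel_right_left)

lemma center_linear_diff: "center_linear \<psi> \<Longrightarrow> \<psi> (x - y) = \<psi> x - \<psi> y"
  unfolding center_linear_def by (metis add_diff_cancel_right' diff_add_cancel)

section \<open>Polynomial functions with coefficients in the division ring\<close>

text \<open>Binomials instead of monomials: by Pascal's rule, summation over \<open>k\<close> only
  raises the lower index, so antidifferences need no division. The binomial values are central,
  while the coefficients need not commute with each other.\<close>

inductive polyfun :: "(nat \<Rightarrow> 'a::division_ring) \<Rightarrow> bool" where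
  binomial: "polyfun (\<lambda>k. c * of_nat (k choose l))"
| add: "polyfun f \<Longrightarrow> polyfun g \<Longrightarrow> polyfun (\<lambda>k. f k + g k)"

lemma polyfun_const [simp]: "polyfun (\<lambda>k. c)"
  using polyfun.binomial[of c 0] by simp

lemma polyfun_cmult_left: "polyfun f \<Longrightarrow> polyfun (\<lambda>k. c * f k)"
proof (induction rule: polyfun.induct)
  case (binomial d l)
  show ?case using polyfun.binomial[of "c * d" l] by (simp add: mult.assoc)
qed (simp add: distrib_left polyfun.add)

lemma polyfun_diff: "polyfun f \<Longrightarrow> polyfun g \<Longrightarrow> polyfun (\<lambda>k. f k - g k)"
  using polyfun.add[of f "\<lambda>k. - 1 * g k"] polyfun_cmult_left[of g "- 1"] by simp

lemma polyfun_sum: "(\<And>i. i \<in> I \<Longrightarrow> polyfun (f i)) \<Longrightarrow> polyfun (\<lambda>k. \<Sum>i\<in>I. f i k)"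
  by (induction I rule: infinite_finite_induct) (auto intro: polyfun.add)

text \<open>The subtraction-free form of
  \<open>(k - l) * (k choose l) = Suc l * (k choose Suc l)\<close>. It keeps multiplication by
  \<open>k\<close> within the span of the binomials and also serves as a recursion in
  \<open>l\<close>.\<close>

lemma of_nat_times_choose:
  "k * (k choose l) = Suc l * (k choose Suc l) + l * (k choose l)"
proof (cases k)
  case (Suc m)
  have *: "Suc j * (Suc m choose Suc j) = Suc m * (m choose j)" for j
    using Suc_times_binomial_eq[of m j] by (simp add: mult.commute)
  show ?thesis
  proof (cases l)
    case 0
    then show ?thesis
      using Suc *[of 0] by simp
  next
    case (Suc j)
    then show ?thesis
      unfolding \<open>k = Suc m\<close> Suc * by (simp add: distrib_left)
  qed
qed auto

lemma polyfun_of_nat_mult: "polyfun f \<Longrightarrow> polyfun (\<lambda>k. of_nat k * f k)"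
proof (induction rule: polyfun.induct)
  case (binomial c l)
  have "of_nat k * (c * of_nat (k choose l))
      = c * of_nat (Suc l) * of_nat (k choose Suc l) + c * of_nat l * of_nat (k choose l)" for k
  proof -
    have "of_nat k * (c * of_nat (k choose l)) = c * of_nat (k * (k choose l))"
      by (metis mult.assoc mult_of_nat_commute of_nat_mult)
    then show ?thesis
      unfolding of_nat_times_choose by (simp add: distrib_left distrib_right mult.assoc)
  qed
  then show ?case by (simp only: polyfun.intros)
qed (simp add: distrib_left polyfun.add)

text \<open>Characteristic zero enters here: the recursion that leads from \<open>k choose l\<close>
  to \<open>k choose Suc l\<close> divides by \<open>Suc l\<close>.\<close>

lemma polyfun_choose_mult:
  fixes f :: "nat \<Rightarrow> 'a::{division_ring, ring_char_0}"
  shows "polyfun f \<Longrightarrow> polyfun (\<lambda>k. of_nat (k choose l) * f k)"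
proof (induction l)
  case (Suc l)
  let ?g = "\<lambda>k. of_nat (k choose l) * f k"
  have "of_nat (k choose Suc l) * f k = inverse (of_nat (Suc l)) * (of_nat k * ?g k - of_nat l * ?g k)" for k
  proof -
    have "of_nat (Suc l) * (of_nat (k choose Suc l) * f k) = (of_nat k * ?g k - of_nat l * ?g k)"
      using arg_cong[OF of_nat_times_choose[of k l], of "\<lambda>x. of_nat x * f k"]
      by (simp add: distrib_right mult.assoc)
    then show ?thesis
      by (metis (no_types, lifting) left_inverse mult.assoc mult_1 of_nat_Suc of_nat_neq_0)
  qed
  then show ?case
    by (simp only: Suc polyfun_diff polyfun_of_nat_mult polyfun_cmult_left)
qed simp

lemma polyfun_mult:
  fixes f g :: "nat \<Rightarrow> 'a::{division_ring, ring_char_0}"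
  assumes "polyfun f" "polyfun g"
  shows "polyfun (\<lambda>k. f k * g k)"
  using assms
proof (induction rule: polyfun.induct)
  case (binomial c l)
  then show ?case
    using polyfun_cmult_left[OF polyfun_choose_mult[of g l], of c] by (simp add: mult.assoc)
qed (simp add: distrib_right polyfun.add)

text \<open>By Pascal's rule \<open>k choose Suc l\<close> has the difference
  \<open>k choose l\<close>, so \<open>h\<close> is built term by term; \<open>f\<close> differs
  from it by the constant \<open>f 0\<close>.\<close>

lemma polyfun_antidifference:
  assumes "polyfun g" "\<And>k. f (Suc k) = f k + g k"
  shows "polyfun f"
proof -
  have "\<exists>h. polyfun h \<and> h 0 = 0 \<and> (\<forall>k. h (Suc k) = h k + g k)"
    using assms(1)
  proof (induction rule: polyfun.induct)
    case (binomial c l)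
    show ?case
      by (rule exI[of _ "\<lambda>k. c * of_nat (k choose Suc l)"]) 
        (simp add: polyfun.binomial distrib_left add.commute)
  next
    case (add f g)
    then obtain F G where "polyfun F \<and> F 0 = 0 \<and> (\<forall>k. F (Suc k) = F k + f k)"
      "polyfun G \<and> G 0 = 0 \<and> (\<forall>k. G (Suc k) = G k + g k)" by blast
    then show ?case
      by (intro exI[of _ "\<lambda>k. F k + G k"]) (simp add: polyfun.add algebra_simps)
  qed
  then obtain h where h: "polyfun h" "h 0 = 0" "\<And>k. h (Suc k) = h k + g k" by blast
  have "f 0 + h k = f k" for k
    by (induction k) (simp_all add: h assms(2) flip: add.assoc)
  then show ?thesis
    using polyfun.add[OF polyfun_const[of "f 0"] h(1)] by simp
qed

section \<open>Reduction to commutative polynomials over the center\<close>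

lemma choose_eq_poly:
  "\<exists>p::'b::field_char_0 poly. \<forall>k. of_nat (k choose l) = poly p (of_nat k)"
proof (induction l)
  case 0
  show ?case by (rule exI[of _ 1]) simp
next
  case (Suc l)
  then obtain p :: "'b poly" where p: "\<And>k. of_nat (k choose l) = poly p (of_nat k)" by blast
  have "of_nat (k choose Suc l)
      = poly (smult (inverse (of_nat (Suc l))) ([:- of_nat l, 1:] * p)) (of_nat k :: 'b)" for k
  proof -
    have "of_nat (Suc l) * of_nat (k choose Suc l) = (of_nat k - of_nat l) * (of_nat (k choose l) :: 'b)"
      using arg_cong[OF of_nat_times_choose[of k l], of "of_nat :: nat \<Rightarrow> 'b"]
      unfolding of_nat_add of_nat_mult left_diff_distrib by simp
    then have "of_nat (k choose Suc l)
        = inverse (of_nat (Suc l)) * ((of_nat k - of_nat l) * (of_nat (k choose l) :: 'b))"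
      by (metis (no_types, lifting) left_inverse mult.assoc mult_1 of_nat_neq_0)
    then show ?thesis
      by (simp add: p[symmetric] left_diff_distrib right_diff_distrib del: of_nat_Suc)
  qed
  then show ?case by blast
qed

text \<open>Binomial values lie in the center, so \<psi> moves past them and only the coefficients
  are mapped. This is the passage from noncommuting coefficients to
  \<open>'a center poly\<close>.\<close>

lemma polyfun_center_linear:
  fixes f :: "nat \<Rightarrow> 'a::{division_ring, ring_char_0}"
  assumes "polyfun f" "center_linear \<psi>"
  shows "\<exists>p. \<forall>k. \<psi> (f k) = poly p (of_nat k)"
  using assms(1)
proof (induction rule: polyfun.induct)
  case (binomial c l)
  obtain p where p: "\<And>k. of_nat (k choose l) = poly p (of_nat k :: 'a center)"
    using choose_eq_poly[of l] by blast
  have "\<psi> (c * of_nat m) = of_nat m * \<psi> c" for m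
    using assms(2) unfolding center_linear_def by (metis cval_of_nat mult_of_nat_commute)
  then show ?case
    by (intro exI[of _ "p * [:\<psi> c:]"]) (simp add: p mult.commute)
next
  case (add f g)
  then obtain p q where "\<forall>k. \<psi> (f k) = poly p (of_nat k)" "\<forall>k. \<psi> (g k) = poly q (of_nat k)"
    by blast
  then show ?case
    using assms(2) by (intro exI[of _ "p + q"]) (simp add: center_linear_def)
qed

lemma poly_eq_if_infinite_nats:
  fixes p q :: "'b::field_char_0 poly"
  assumes "infinite K" "\<And>k. k \<in> K \<Longrightarrow> poly p (of_nat k) = poly q (of_nat k)"
  shows "p = q"
proof (rule ccontr)
  assume "p \<noteq> q"
  then have "finite {x. poly (p - q) x = 0}"
    by (intro poly_roots_finite) simp
  moreover have "of_nat ` K \<subseteq> {x. poly (p - q) x = 0}"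
    using assms(2) by auto
  ultimately have "finite (of_nat ` K :: 'b set)"
    by (rule rev_finite_subset)
  then show False
    using assms(1) by (simp add: finite_image_iff inj_on_def)
qed

text \<open>A nonzero value would be seen by some form over the center, under which the function
  becomes an ordinary polynomial with infinitely many zeros.\<close>

lemma polyfun_eq_0_if_infinite_zeros:
  fixes f :: "nat \<Rightarrow> 'a::{division_ring, ring_char_0}"
  assumes "polyfun f" "infinite K" "\<And>k. k \<in> K \<Longrightarrow> f k = 0"
  shows "f k = 0"
proof (rule ccontr)
  assume "f k \<noteq> 0"
  then obtain \<psi> where \<psi>: "center_linear \<psi>" "\<psi> (f k) = 1"
    using center_linear_exists by blast
  obtain p where p: "\<And>k. \<psi> (f k) = poly p (of_nat k)"
    using polyfun_center_linear[OF assms(1) \<psi>(1)] by blast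
  have "p = 0"
    using assms(2) by (rule poly_eq_if_infinite_nats) (simp add: p[symmetric] assms(3) \<psi>(1))
  then show False
    using p[of k] \<psi>(2) by simp
qed

section \<open>Linear algebra over a division ring\<close>

text \<open>Gaussian elimination by induction on the number of equations, with coefficients on the
  left and unknowns on the right, as for a matrix acting on the right vector space.\<close>

lemma homogeneous_system_nontrivial:
  fixes a :: "nat \<Rightarrow> 'i \<Rightarrow> 'a::division_ring"
  assumes "finite J" "n < card J"
  shows "\<exists>x. (\<exists>j\<in>J. x j \<noteq> 0) \<and> (\<forall>i<n. (\<Sum>j\<in>J. a i j * x j) = 0)"
  using assms
proof (induction n arbitrary: a J)
  case 0
  then have "J \<noteq> {}" by auto
  then show ?case by (intro exI[of _ "\<lambda>_. 1"]) auto
next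
  case (Suc n)
  show ?case
  proof (cases "\<forall>j\<in>J. a n j = 0")
    case True
    obtain x where "\<exists>j\<in>J. x j \<noteq> 0" "\<forall>i<n. (\<Sum>j\<in>J. a i j * x j) = 0"
      using Suc.IH[of J a] Suc.prems by auto
    then show ?thesis
      using True by (intro exI[of _ x]) (auto simp: less_Suc_eq)
  next
    case False
    then obtain p where p: "p \<in> J" "a n p \<noteq> 0" by blast
    let ?J = "J - {p}"
    define b where "b i j = a i j - a i p * inverse (a n p) * a n j" for i j
    have "n < card ?J" "finite ?J"
      using Suc.prems p(1) by auto
    from Suc.IH[OF this(2,1), of b] obtain x where
      x: "\<exists>j\<in>?J. x j \<noteq> 0" "\<forall>i<n. (\<Sum>j\<in>?J. b i j * x j) = 0" by blast
    define y where "y j = (if j = p then - inverse (a n p) * (\<Sum>j\<in>?J. a n j * x j) else x j)" for j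
    have split: "(\<Sum>j\<in>J. a i j * y j)
        = (\<Sum>j\<in>?J. a i j * x j) - a i p * inverse (a n p) * (\<Sum>j\<in>?J. a n j * x j)" for i
    proof -
      have "(\<Sum>j\<in>J. a i j * y j) = a i p * y p + (\<Sum>j\<in>?J. a i j * y j)"
        using Suc.prems(1) p(1) by (simp add: sum.remove)
      also have "(\<Sum>j\<in>?J. a i j * y j) = (\<Sum>j\<in>?J. a i j * x j)"
        by (rule sum.cong) (auto simp: y_def)
      finally show ?thesis by (simp add: y_def mult.assoc)
    qed
    have "(\<Sum>j\<in>J. a i j * y j) = 0" if "i < Suc n" for i
    proof (cases "i = n")
      case True
      then show ?thesis using p(2) by (simp add: split)
    next
      case False
      with that have "i < n" by simp
      then have "(\<Sum>j\<in>?J. b i j * x j) = 0" using x(2) by blast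
      then show ?thesis
        by (simp add: split b_def left_diff_distrib sum_subtractf sum_distrib_left mult.assoc)
    qed
    moreover have "\<exists>j\<in>J. y j \<noteq> 0"
      using x(1) by (auto simp: y_def)
    ultimately show ?thesis by blast
  qed
qed

text \<open>Injectivity says that the columns are right linearly independent, and
  \<open>mat_range\<close> is their right span. An injective matrix thus stands for a basis of its
  range.\<close>

definition inj_mat :: "'a::division_ring mat \<Rightarrow> bool" where
  "inj_mat M \<longleftrightarrow> (\<forall>v\<in>carrier_vec (dim_col M). M *\<^sub>v v = 0\<^sub>v (dim_row M) \<longrightarrow> v = 0\<^sub>v (dim_col M))"

definition mat_range :: "'a::division_ring mat \<Rightarrow> 'a vec set" where
  "mat_range M = (*\<^sub>v) M ` carrier_vec (dim_col M)"

lemma inj_matD: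
  assumes "inj_mat M" "M \<in> carrier_mat n d" "v \<in> carrier_vec d" "M *\<^sub>v v = 0\<^sub>v n"
  shows "v = 0\<^sub>v d"
  using assms unfolding inj_mat_def by auto

lemma inj_matI:
  assumes "M \<in> carrier_mat n d" "\<And>v. v \<in> carrier_vec d \<Longrightarrow> M *\<^sub>v v = 0\<^sub>v n \<Longrightarrow> v = 0\<^sub>v d"
  shows "inj_mat M"
  using assms unfolding inj_mat_def by auto

lemma inj_mat_dim_le:
  assumes "inj_mat M" "M \<in> carrier_mat n d"
  shows "d \<le> n"
proof (rule ccontr)
  assume "\<not> d \<le> n"
  then obtain x where x: "\<exists>j\<in>{0..<d}. x j \<noteq> 0" "\<forall>i<n. (\<Sum>j\<in>{0..<d}. M $$ (i, j) * x j) = 0"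
    using homogeneous_system_nontrivial[of "{0..<d}" n "\<lambda>i j. M $$ (i, j)"] by auto
  have "M *\<^sub>v vec d x = 0\<^sub>v n"
    using x(2) assms(2) by (intro eq_vecI) (auto simp: scalar_prod_def)
  then have "vec d x = 0\<^sub>v d"
    using inj_matD[OF assms] by auto
  then show False
    using x(1) by (metis atLeastLessThan_iff index_vec index_zero_vec(1))
qed

section \<open>Right subspaces, independent columns and dimension\<close>

lemma rsmult_vec_carrier [simp]: "v \<in> carrier_vec n \<Longrightarrow> rsmult_vec v c \<in> carrier_vec n"
  by (simp add: rsmult_vec_def)

lemma index_rsmult_vec [simp]: "i < dim_vec v \<Longrightarrow> rsmult_vec v c $ i = v $ i * c"
  by (simp add: rsmult_vec_def)

lemma dim_rsmult_vec [simp]: "dim_vec (rsmult_vec v c) = dim_vec v"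
  by (simp add: rsmult_vec_def)

lemma mult_mat_rsmult_vec:
  fixes A :: "'a::ring_1 mat"
  assumes "A \<in> carrier_mat n m" "v \<in> carrier_vec m"
  shows "A *\<^sub>v rsmult_vec v c = rsmult_vec (A *\<^sub>v v) c"
  using assms by (intro eq_vecI) (auto simp: scalar_prod_def sum_distrib_right mult.assoc)

lemma right_subspace_mat_range:
  assumes "M \<in> carrier_mat n d"
  shows "right_subspace n (mat_range M)"
proof -
  have "0\<^sub>v n = M *\<^sub>v 0\<^sub>v d"
    using assms by (intro eq_vecI) auto
  moreover have "M *\<^sub>v v + M *\<^sub>v w \<in> mat_range M" if "v \<in> carrier_vec d" "w \<in> carrier_vec d" for v w
    using assms that mult_add_distrib_mat_vec[OF assms that] 
    unfolding mat_range_def by (metis add_carrier_vec carrier_matD(2) image_eqI)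
  moreover have "rsmult_vec (M *\<^sub>v v) c \<in> mat_range M" if "v \<in> carrier_vec d" for v c
    using assms that mult_mat_rsmult_vec[OF assms that]
    unfolding mat_range_def by (metis rsmult_vec_carrier carrier_matD(2) image_eqI)
  ultimately show ?thesis
    using assms unfolding right_subspace_def by (auto simp: mat_range_def)
qed

definition append_col :: "'a::division_ring mat \<Rightarrow> 'a vec \<Rightarrow> 'a mat" where
  "append_col M u = mat (dim_row M) (Suc (dim_col M)) (\<lambda>(i, j). if j < dim_col M then M $$ (i, j) else u $ i)"

lemma append_col_carrier: "M \<in> carrier_mat n d \<Longrightarrow> append_col M u \<in> carrier_mat n (Suc d)"
  by (auto simp: append_col_def)

lemma append_col_mult_vec:
  assumes "M \<in> carrier_mat n d" "u \<in> carrier_vec n" "v \<in> carrier_vec (Suc d)"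
  shows "append_col M u *\<^sub>v v = M *\<^sub>v vec d (($) v) + rsmult_vec u (v $ d)"
  using assms by (intro eq_vecI) (auto simp: append_col_def scalar_prod_def)

lemma inj_mat_append_col:
  assumes "M \<in> carrier_mat n d" "inj_mat M" "u \<in> carrier_vec n" "u \<notin> mat_range M"
  shows "inj_mat (append_col M u)"
proof (rule inj_matI[OF append_col_carrier[OF assms(1)]])
  fix v :: "'a vec"
  assume v: "v \<in> carrier_vec (Suc d)" and "append_col M u *\<^sub>v v = 0\<^sub>v n"
  then have eq: "M *\<^sub>v vec d (($) v) + rsmult_vec u (v $ d) = 0\<^sub>v n"
    using append_col_mult_vec[OF assms(1,3) v] by simp
  have vd: "v $ d = 0"
  proof (rule ccontr)
    assume nz: "v $ d \<noteq> 0"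
    \<comment> \<open>A relation with \<open>v $ d \<noteq> 0\<close> can be solved for
      \<open>u\<close> by dividing by \<open>v $ d\<close> on the right; \<open>w\<close> holds the
      resulting coefficients.\<close>
    define w where "w = rsmult_vec (vec d (($) v)) (- inverse (v $ d))"
    have "M *\<^sub>v w = rsmult_vec (M *\<^sub>v vec d (($) v)) (- inverse (v $ d))"
      unfolding w_def using assms(1) by (rule mult_mat_rsmult_vec) simp
    also have "\<dots> = u"
    proof (rule eq_vecI)
      fix i assume "i < dim_vec u"
      then have i: "i < n" using assms(3) by auto
      have "(M *\<^sub>v vec d (($) v) + rsmult_vec u (v $ d)) $ i = 0"
        unfolding eq using i by simp
      then have "(M *\<^sub>v vec d (($) v)) $ i = - (u $ i * v $ d)"
        using i assms(1,3) by (simp add: eq_neg_iff_add_eq_0)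
      then show "rsmult_vec (M *\<^sub>v vec d (($) v)) (- inverse (v $ d)) $ i = u $ i"
        using i assms(1) nz by (simp add: mult.assoc)
    qed (use assms in auto)
    finally have "u \<in> mat_range M"
      using assms(1) unfolding mat_range_def w_def by auto
    then show False using assms(4) by blast
  qed
  have "rsmult_vec u (v $ d) = 0\<^sub>v n"
    unfolding vd using assms(3) by (intro eq_vecI) auto
  then have "M *\<^sub>v vec d (($) v) = 0\<^sub>v n"
    using eq assms(1) by (metis carrier_matD(1) mult_mat_vec_carrier right_zero_vec vec_carrier)
  then have v0: "vec d (($) v) = 0\<^sub>v d"
    by (rule inj_matD[OF assms(2,1) vec_carrier])
  show "v = 0\<^sub>v (Suc d)"
  proof (rule eq_vecI)
    fix i assume "i < dim_vec (0\<^sub>v (Suc d) :: 'a vec)"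
    then consider "i = d" | "i < d" by fastforce
    then show "v $ i = 0\<^sub>v (Suc d) $ i"
      by cases (use vd v0 in \<open>auto dest: arg_cong[where f = "\<lambda>x. x $ i"]\<close>)
  qed (use v in auto)
qed

lemma mat_range_append_col:
  assumes "M \<in> carrier_mat n d" "right_subspace n V" "mat_range M \<subseteq> V" "u \<in> V"
  shows "mat_range (append_col M u) \<subseteq> V"
proof -
  have "append_col M u *\<^sub>v v \<in> V" if v: "v \<in> carrier_vec (Suc d)" for v
  proof -
    have u: "u \<in> carrier_vec n"
      using assms(2,4) by (auto simp: right_subspace_def)
    have "M *\<^sub>v vec d (($) v) \<in> V"
      using assms(1,3) by (auto simp: mat_range_def)
    then show ?thesis
      unfolding append_col_mult_vec[OF assms(1) u v]
      using assms(2,4) unfolding right_subspace_def by blast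
  qed
  then show ?thesis
    using carrier_matD(2)[OF append_col_carrier[OF assms(1)]] by (auto simp: mat_range_def)
qed

text \<open>The largest size of an independent family inside \<open>V\<close>, bounded by
  \<open>inj_mat_dim_le\<close>. Being a function, unlike \<open>has_right_dim\<close>, it can be
  compared and minimized before any basis is known.\<close>

definition sdim :: "nat \<Rightarrow> 'a::division_ring vec set \<Rightarrow> nat" where
  "sdim n V = (GREATEST d. \<exists>M\<in>carrier_mat n d. inj_mat M \<and> mat_range M \<subseteq> V)"

lemma sdim_ge:
  assumes "M \<in> carrier_mat n d" "inj_mat M" "mat_range M \<subseteq> V"
  shows "d \<le> sdim n V"
  unfolding sdim_def
  by (rule Greatest_le_nat[where b = n]) (use assms inj_mat_dim_le in blast)+

text \<open>An independent family of maximal size spans, since any vector of \<open>V\<close>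
  outside its range could be appended to it.\<close>

lemma right_subspace_basis:
  assumes "right_subspace n (V :: 'a::division_ring vec set)"
  obtains M where "M \<in> carrier_mat n (sdim n V)" "inj_mat M" "mat_range M = V"
proof -
  let ?P = "\<lambda>d. \<exists>M\<in>carrier_mat n d. inj_mat M \<and> mat_range M \<subseteq> V"
  have "inj_mat (mat n 0 (\<lambda>_. 0) :: 'a mat)"
    by (auto simp: inj_mat_def)
  moreover have "mat_range (mat n 0 (\<lambda>_. 0) :: 'a mat) \<subseteq> V"
  proof -
    have "mat n 0 (\<lambda>_. 0) *\<^sub>v v = 0\<^sub>v n" if "v \<in> carrier_vec 0" for v :: "'a vec"
      using that by (intro eq_vecI) (auto simp: scalar_prod_def)
    then show ?thesis
      using assms by (auto simp: mat_range_def right_subspace_def)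
  qed
  ultimately have "?P 0" by (intro bexI[of _ "mat n 0 (\<lambda>_. 0)"]) auto
  moreover have "d \<le> n" if "?P d" for d
    using that inj_mat_dim_le by blast
  ultimately have "?P (sdim n V)"
    unfolding sdim_def by (rule GreatestI_nat)
  then obtain M where M: "M \<in> carrier_mat n (sdim n V)" "inj_mat M" "mat_range M \<subseteq> V" by blast
  have "u \<in> mat_range M" if u: "u \<in> V" for u
  proof (rule ccontr)
    assume "u \<notin> mat_range M"
    moreover have "u \<in> carrier_vec n"
      using u assms by (auto simp: right_subspace_def)
    ultimately have "inj_mat (append_col M u)"
      by (intro inj_mat_append_col[OF M(1,2)])
    then have "Suc (sdim n V) \<le> sdim n V"
      using sdim_ge[OF append_col_carrier[OF M(1)] _ mat_range_append_col[OF M(1) assms M(3) u]]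
      by blast
    then show False by simp
  qed
  with M show thesis by (intro that) auto
qed

lemma sdim_le: "right_subspace n (V :: 'a::division_ring vec set) \<Longrightarrow> sdim n V \<le> n"
  by (metis right_subspace_basis inj_mat_dim_le)

lemma sdim_strict_mono:
  assumes "right_subspace n (V :: 'a::division_ring vec set)" "right_subspace n W" "V \<subset> W"
  shows "sdim n V < sdim n W"
proof -
  obtain M where M: "M \<in> carrier_mat n (sdim n V)" "inj_mat M" "mat_range M = V"
    using right_subspace_basis[OF assms(1)] .
  obtain u where u: "u \<in> W" "u \<notin> V" using assms(3) by blast
  have "u \<in> carrier_vec n"
    using u assms(2) by (auto simp: right_subspace_def)
  then have "Suc (sdim n V) \<le> sdim n W"
    using M u assms(3)
    by (intro sdim_ge[OF append_col_carrier[OF M(1)]] inj_mat_append_col[OF M(1,2)]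
          mat_range_append_col[OF M(1) assms(2)]) auto
  then show ?thesis by simp
qed

text \<open>A vector outside the range would give \<open>n + 1\<close> independent columns of length
  \<open>n\<close>.\<close>

lemma inj_mat_square_surj:
  assumes "T \<in> carrier_mat n n" "inj_mat T"
  shows "mat_range T = carrier_vec n"
proof (intro equalityI subsetI)
  fix u :: "'a vec" assume u: "u \<in> carrier_vec n"
  show "u \<in> mat_range T"
  proof (rule ccontr)
    assume "u \<notin> mat_range T"
    then have "Suc n \<le> n"
      by (intro inj_mat_dim_le[OF inj_mat_append_col[OF assms u] append_col_carrier[OF assms(1)]])
    then show False by simp
  qed
qed (use assms(1) in \<open>auto simp: mat_range_def\<close>)

lemma right_inverse_if_surj:
  assumes "T \<in> carrier_mat n d" "mat_range T = carrier_vec n"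
  shows "\<exists>R\<in>carrier_mat d n. T * R = (1\<^sub>m n :: 'a::division_ring mat)"
proof -
  have "\<forall>j. \<exists>v\<in>carrier_vec d. T *\<^sub>v v = unit_vec n j"
    using assms unfolding mat_range_def by (metis carrier_matD(2) imageE unit_vec_carrier)
  then obtain f where f: "\<And>j. f j \<in> carrier_vec d" "\<And>j. T *\<^sub>v f j = unit_vec n j" by metis
  define R where "R = mat d n (\<lambda>(i, j). f j $ i)"
  have R: "R \<in> carrier_mat d n" by (simp add: R_def)
  have "T * R = 1\<^sub>m n"
  proof (rule eq_matI)
    fix i j assume "i < dim_row (1\<^sub>m n :: 'a mat)" "j < dim_col (1\<^sub>m n :: 'a mat)"
    then have ij: "i < n" "j < n" by auto
    have "col R j = f j"
      using f(1)[of j] ij by (intro eq_vecI) (auto simp: R_def)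
    then have "(T * R) $$ (i, j) = (T *\<^sub>v f j) $ i"
      using ij assms(1) R by simp
    then show "(T * R) $$ (i, j) = 1\<^sub>m n $$ (i, j)"
      using ij by (simp add: f(2) unit_vec_def)
  qed (use assms R in auto)
  then show ?thesis using R by blast
qed

lemma inj_mat_if_left_inverse:
  assumes "T \<in> carrier_mat n d" "L \<in> carrier_mat d n" "L * T = (1\<^sub>m d :: 'a::division_ring mat)"
  shows "inj_mat T"
proof (rule inj_matI[OF assms(1)])
  fix v assume v: "v \<in> carrier_vec d" "T *\<^sub>v v = 0\<^sub>v n"
  have "v = (L * T) *\<^sub>v v" using v(1) by (simp add: assms(3))
  also have "\<dots> = L *\<^sub>v 0\<^sub>v n" using assms(1,2) v by (simp add: v(2))
  also have "\<dots> = 0\<^sub>v d" using assms(2) by (intro eq_vecI) auto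
  finally show "v = 0\<^sub>v d" .
qed

lemma inj_mat_left_cancel:
  assumes "inj_mat T" "T \<in> carrier_mat n d" "A \<in> carrier_mat d m" "B \<in> carrier_mat d m" "T * A = T * B"
  shows "A = (B :: 'a::division_ring mat)"
proof (rule mat_col_eqI)
  fix j assume "j < dim_col B"
  then have j: "j < m" using assms(4) by auto
  have "T *\<^sub>v (col A j - col B j) = T *\<^sub>v col A j - T *\<^sub>v col B j"
    using assms j by (intro mult_minus_distrib_mat_vec[of _ n d]) auto
  also have "\<dots> = col (T * A) j - col (T * B) j"
    using assms(2-4) j by (simp add: col_mult2[OF assms(2,3) j] col_mult2[OF assms(2,4) j])
  also have "\<dots> = 0\<^sub>v n" using assms by (simp add: assms(5)) (intro eq_vecI; auto)
  finally have *: "col A j - col B j = 0\<^sub>v d"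
    using assms(3,4) by (intro inj_matD[OF assms(1,2) minus_carrier_vec]) auto
  show "col A j = col B j"
  proof (rule eq_vecI)
    fix i assume "i < dim_vec (col B j)"
    then have i: "i < d" using assms(4) by auto
    have "(col A j - col B j) $ i = 0" using * i by simp
    then show "col A j $ i = col B j $ i"
      using i assms(3,4) by (simp add: j)
  qed (use assms in auto)
qed (use assms in auto)

lemma inj_mat_square_inverse:
  assumes "T \<in> carrier_mat n n" "inj_mat T"
  obtains T' where "T' \<in> carrier_mat n n" "T * T' = 1\<^sub>m n" "T' * T = (1\<^sub>m n :: 'a::division_ring mat)"
proof -
  obtain R where R: "R \<in> carrier_mat n n" "T * R = 1\<^sub>m n"
    using right_inverse_if_surj[OF assms(1) inj_mat_square_surj[OF assms]] by blast
  have "T * (R * T) = T * 1\<^sub>m n"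
    using assoc_mult_mat[OF assms(1) R(1) assms(1)] R(2) assms(1) by simp
  then have "R * T = 1\<^sub>m n"
    by (rule inj_mat_left_cancel[OF assms(2,1) mult_carrier_mat[OF R(1) assms(1)] one_carrier_mat])
  then show thesis by (rule that[OF R])
qed

definition coord_subspace :: "nat \<Rightarrow> nat \<Rightarrow> 'a::zero vec set" where
  "coord_subspace n d = {v \<in> carrier_vec n. \<forall>i<n. d \<le> i \<longrightarrow> v $ i = 0}"

text \<open>The columns of \<open>T\<close> form a basis of the whole space whose first
  \<open>sdim n V\<close> members are a basis of \<open>V\<close>. In these coordinates, invariance
  of \<open>V\<close> becomes a zero lower left block.\<close>

lemma right_subspace_coordinates:
  assumes "right_subspace n (V :: 'a::division_ring vec set)"
  obtains T T' where "T \<in> carrier_mat n n" "T' \<in> carrier_mat n n" "T * T' = 1\<^sub>m n" "T' * T = 1\<^sub>m n"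
    "V = (*\<^sub>v) T ` coord_subspace n (sdim n V)"
proof -
  let ?d = "sdim n V"
  obtain M where M: "M \<in> carrier_mat n ?d" "inj_mat M" "mat_range M = V"
    using right_subspace_basis[OF assms] .
  let ?ext = "\<lambda>X. \<forall>i<n. \<forall>j<?d. X $$ (i, j) = M $$ (i, j)"
  let ?P = "\<lambda>e. ?d \<le> e \<and> (\<exists>X\<in>carrier_mat n e. inj_mat X \<and> ?ext X)"
  \<comment> \<open>The largest width of an injective matrix that starts with the columns of
    \<open>M\<close>; as no column can be appended, such a matrix is surjective.\<close>
  define e where "e = (GREATEST e. ?P e)"
  have bound: "x \<le> n" if "?P x" for x using that inj_mat_dim_le by blast
  have "?P ?d" using M by blast
  then have "?P e" unfolding e_def using bound by (rule GreatestI_nat)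
  then obtain X where X: "?d \<le> e" "X \<in> carrier_mat n e" "inj_mat X" "?ext X" by blast
  have surj: "mat_range X = carrier_vec n"
  proof (intro equalityI subsetI)
    fix u :: "'a vec" assume u: "u \<in> carrier_vec n"
    show "u \<in> mat_range X"
    proof (rule ccontr)
      assume "u \<notin> mat_range X"
      then have "inj_mat (append_col X u)" by (intro inj_mat_append_col[OF X(2,3) u])
      moreover have "?ext (append_col X u)" using X(1,2,4) by (auto simp: append_col_def)
      ultimately have "?P (Suc e)"
        using append_col_carrier[OF X(2)] by (intro conjI le_SucI[OF X(1)] bexI[of _ "append_col X u"])
      then have "Suc e \<le> (GREATEST e. ?P e)" using bound by (rule Greatest_le_nat)
      then show False unfolding e_def[symmetric] by simp
    qed
  qed (use X(2) in \<open>auto simp: mat_range_def\<close>)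
  then obtain R where R: "R \<in> carrier_mat e n" "X * R = 1\<^sub>m n"
    using right_inverse_if_surj[OF X(2)] by blast
  \<comment> \<open>The right inverse \<open>R\<close> is injective because \<open>X\<close> is a
    left inverse of it, and it has \<open>n\<close> columns of length \<open>e\<close>.\<close>
  have "n \<le> e"
    using inj_mat_dim_le[OF inj_mat_if_left_inverse[OF R(1) X(2) R(2)] R(1)] .
  moreover have "e \<le> n" using inj_mat_dim_le[OF X(3,2)] .
  ultimately have "e = n" by simp
  with X have X: "?d \<le> n" "X \<in> carrier_mat n n" "inj_mat X" "?ext X" by auto
  obtain T' where T': "T' \<in> carrier_mat n n" "X * T' = 1\<^sub>m n" "T' * X = 1\<^sub>m n"
    using inj_mat_square_inverse[OF X(2,3)] .
  have eq: "X *\<^sub>v v = M *\<^sub>v vec ?d (($) v)" if v: "v \<in> coord_subspace n ?d" for v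
  proof (rule eq_vecI)
    fix i assume "i < dim_vec (M *\<^sub>v vec ?d (($) v))"
    then have i: "i < n" using M(1) by auto
    have "(X *\<^sub>v v) $ i = (\<Sum>j\<in>{0..<n}. X $$ (i, j) * v $ j)"
      using i X(2) v by (auto simp: scalar_prod_def coord_subspace_def)
    also have "\<dots> = (\<Sum>j\<in>{0..<?d}. X $$ (i, j) * v $ j)"
      using X(1) v by (intro sum.mono_neutral_right) (auto simp: coord_subspace_def)
    also have "\<dots> = (\<Sum>j\<in>{0..<?d}. M $$ (i, j) * v $ j)"
      using X(4) i by (intro sum.cong) auto
    also have "\<dots> = (M *\<^sub>v vec ?d (($) v)) $ i"
      using i M(1) by (auto simp: scalar_prod_def)
    finally show "(X *\<^sub>v v) $ i = (M *\<^sub>v vec ?d (($) v)) $ i" .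
  qed (use X(2) M(1) in auto)
  have "V = (*\<^sub>v) X ` coord_subspace n ?d"
  proof (intro equalityI subsetI)
    fix x assume "x \<in> V"
    then obtain w where w: "w \<in> carrier_vec ?d" "x = M *\<^sub>v w"
      using M by (auto simp: mat_range_def)
    let ?v = "vec n (\<lambda>i. if i < ?d then w $ i else 0)"
    have "vec ?d (($) ?v) = w" using w(1) X(1) by (intro eq_vecI) auto
    moreover have "?v \<in> coord_subspace n ?d" by (simp add: coord_subspace_def)
    ultimately show "x \<in> (*\<^sub>v) X ` coord_subspace n ?d"
      using eq[of ?v] w(2) by (intro image_eqI[of _ _ ?v]) simp_all
  next
    fix x assume "x \<in> (*\<^sub>v) X ` coord_subspace n ?d"
    then obtain v where "v \<in> coord_subspace n ?d" "x = X *\<^sub>v v" by blast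
    then have "x = M *\<^sub>v vec ?d (($) v)" using eq by simp
    then have "x \<in> mat_range M" using M(1) by (auto simp: mat_range_def)
    then show "x \<in> V" by (simp add: M(3))
  qed
  then show thesis by (rule that[OF X(2) T'])
qed

section \<open>Powers of matrices and central scalars\<close>

lemma
  fixes A B :: "'a::ring_1 mat"
  assumes "A \<in> carrier_mat n n" "B \<in> carrier_mat n n"
  shows pow_mat_add: "A ^\<^sub>m (i + j) = A ^\<^sub>m i * A ^\<^sub>m j"
    and pow_mat_commute: "A * B = B * A \<Longrightarrow> A ^\<^sub>m i * B = B * A ^\<^sub>m i"
    and pow_mat_mult_distrib: "A * B = B * A \<Longrightarrow> (A * B) ^\<^sub>m i = A ^\<^sub>m i * B ^\<^sub>m i"
proof -
  let ?R = "ring_mat TYPE('a) n ()"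
  interpret R: semiring ?R by (rule semiring_mat)
  note pow = pow_mat_ring_pow[where b = "()"]
  have mult: "X * Y = X \<otimes>\<^bsub>?R\<^esub> Y" for X Y
    by (simp add: ring_mat_def)
  have carrier: "A \<in> carrier ?R" "B \<in> carrier ?R"
    using assms by (auto simp: ring_mat_def)
  show "A ^\<^sub>m (i + j) = A ^\<^sub>m i * A ^\<^sub>m j"
    unfolding pow[OF assms(1)] mult using R.nat_pow_mult[OF carrier(1)] by simp
  show "A ^\<^sub>m i * B = B * A ^\<^sub>m i" if "A * B = B * A"
    using that R.group_commutes_pow[of A B i] carrier unfolding pow[OF assms(1)] mult by simp
  show "(A * B) ^\<^sub>m i = A ^\<^sub>m i * B ^\<^sub>m i" if "A * B = B * A"
    using R.pow_mult_distrib[OF _ carrier, of i] that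
    unfolding mult[symmetric] pow[OF assms(1), symmetric] pow[OF assms(2), symmetric]
      pow[OF mult_carrier_mat[OF assms], symmetric] by blast
qed

lemma pow_mat_Suc_left: "A \<in> carrier_mat n n \<Longrightarrow> A ^\<^sub>m Suc k = A * A ^\<^sub>m k"
  for A :: "'a::ring_1 mat"
  using pow_mat_commute[of A n A k] by simp

lemma pow_mat_zero_mono:
  fixes A :: "'a::ring_1 mat"
  assumes "A \<in> carrier_mat n n" "A ^\<^sub>m i = 0\<^sub>m n n" "i \<le> j"
  shows "A ^\<^sub>m j = 0\<^sub>m n n"
  using pow_mat_add[OF assms(1,1), of i "j - i"] assms by simp

text \<open>A matrix rather than a use of \<open>smult_mat\<close>, so that the laws of matrix
  multiplication apply; centrality makes it commute with every matrix
  (\<open>scalar_mat_commute\<close>).\<close>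

definition scalar_mat :: "nat \<Rightarrow> 'a::division_ring center \<Rightarrow> 'a mat" where
  "scalar_mat n c = mat n n (\<lambda>(i, j). if i = j then cval c else 0)"

lemma scalar_mat_carrier [simp]: "scalar_mat n c \<in> carrier_mat n n"
  by (simp add: scalar_mat_def)

lemma dim_scalar_mat [simp]: "dim_row (scalar_mat n c) = n" "dim_col (scalar_mat n c) = n"
  by (simp_all add: scalar_mat_def)

lemma scalar_mat_eq_smult: "scalar_mat n c = cval c \<cdot>\<^sub>m 1\<^sub>m n"
  by (intro eq_matI) (auto simp: scalar_mat_def)

lemma scalar_mat_0 [simp]: "scalar_mat n 0 = 0\<^sub>m n n"
  and scalar_mat_1 [simp]: "scalar_mat n 1 = 1\<^sub>m n"
  by (intro eq_matI; auto simp: scalar_mat_def)+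

lemma scalar_mat_diff: "scalar_mat n (c - d) = scalar_mat n c - scalar_mat n d"
  by (intro eq_matI) (auto simp: scalar_mat_def)

lemma scalar_mat_mult_left:
  assumes "A \<in> carrier_mat n m"
  shows "scalar_mat n c * A = cval c \<cdot>\<^sub>m A"
proof (rule eq_matI)
  fix i j assume "i < dim_row (cval c \<cdot>\<^sub>m A)" "j < dim_col (cval c \<cdot>\<^sub>m A)"
  then have ij: "i < n" "j < m" using assms by auto
  have "(scalar_mat n c * A) $$ (i, j) = (\<Sum>k\<in>{0..<n}. (if i = k then cval c else 0) * A $$ (k, j))"
    using ij assms by (simp add: scalar_prod_def scalar_mat_def)
  also have "\<dots> = (\<Sum>k\<in>{0..<n}. if i = k then cval c * A $$ (k, j) else 0)"
    by (rule sum.cong) auto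
  finally have "(scalar_mat n c * A) $$ (i, j) = \<dots>" .
  then show "(scalar_mat n c * A) $$ (i, j) = (cval c \<cdot>\<^sub>m A) $$ (i, j)"
    using ij assms by simp
qed (use assms in auto)

lemma scalar_mat_mult_right:
  assumes "A \<in> carrier_mat n m"
  shows "A * scalar_mat m c = cval c \<cdot>\<^sub>m A"
proof (rule eq_matI)
  fix i j assume "i < dim_row (cval c \<cdot>\<^sub>m A)" "j < dim_col (cval c \<cdot>\<^sub>m A)"
  then have ij: "i < n" "j < m" using assms by auto
  have "(A * scalar_mat m c) $$ (i, j) = (\<Sum>k\<in>{0..<m}. A $$ (i, k) * (if k = j then cval c else 0))"
    using ij assms by (simp add: scalar_prod_def scalar_mat_def)
  also have "\<dots> = (\<Sum>k\<in>{0..<m}. if k = j then A $$ (i, k) * cval c else 0)"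
    by (rule sum.cong) auto
  finally have "(A * scalar_mat m c) $$ (i, j) = \<dots>" .
  then show "(A * scalar_mat m c) $$ (i, j) = (cval c \<cdot>\<^sub>m A) $$ (i, j)"
    using ij assms by (simp add: cval_commute)
qed (use assms in auto)

lemma scalar_mat_commute: "A \<in> carrier_mat n m \<Longrightarrow> A * scalar_mat m c = scalar_mat n c * A"
  by (simp add: scalar_mat_mult_left scalar_mat_mult_right)

lemma scalar_mat_mult: "scalar_mat n (c * d) = scalar_mat n c * scalar_mat n d"
  unfolding scalar_mat_mult_left[OF scalar_mat_carrier]
  by (intro eq_matI) (auto simp: scalar_mat_def)

text \<open>On the last nonvanishing power \<open>?Y\<close> of \<open>X - c\<close>, the matrix
  \<open>X - d\<close> acts as multiplication by \<open>c - d\<close>, so its nilpotency forces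
  \<open>c = d\<close>. For \<open>n = 0\<close> every scalar would qualify.\<close>

lemma nilpotent_shift_unique:
  fixes X :: "'a::division_ring mat"
  assumes "X \<in> carrier_mat n n" "0 < n"
    and "(X - scalar_mat n c) ^\<^sub>m i = 0\<^sub>m n n" "(X - scalar_mat n d) ^\<^sub>m j = 0\<^sub>m n n"
  shows "c = d"
proof (rule ccontr)
  assume "c \<noteq> d"
  let ?N = "X - scalar_mat n c" and ?M = "X - scalar_mat n d"
  have N: "?N \<in> carrier_mat n n" and M: "?M \<in> carrier_mat n n" using assms(1) by auto
  have one: "(1\<^sub>m n :: 'a mat) \<noteq> 0\<^sub>m n n"
    using assms(2) by (metis index_one_mat(1) index_zero_mat(1) zero_neq_one)
  define l where "l = (LEAST l. ?N ^\<^sub>m l = 0\<^sub>m n n)"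
  have l: "?N ^\<^sub>m l = 0\<^sub>m n n" unfolding l_def using assms(3) by (rule LeastI)
  then obtain l' where l': "l = Suc l'" using one assms(1) by (cases l) auto
  let ?Y = "?N ^\<^sub>m l'"
  have Y: "?Y \<in> carrier_mat n n" using N by simp
  have nz: "?Y \<noteq> 0\<^sub>m n n" using l' not_less_Least[of l' "\<lambda>l. ?N ^\<^sub>m l = 0\<^sub>m n n"] by (auto simp: l_def)
  have NY: "?N * ?Y = 0\<^sub>m n n" using l pow_mat_Suc_left[OF N, of l'] by (simp add: l')
  have "?M = ?N + scalar_mat n (c - d)"
    using assms(1) by (intro eq_matI) (auto simp: scalar_mat_diff)
  then have "?M * ?Y = scalar_mat n (c - d) * ?Y"
    using add_mult_distrib_mat[OF N scalar_mat_carrier Y] Y NY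
    by (simp add: left_add_zero_mat[OF mult_carrier_mat[OF scalar_mat_carrier Y]])
  then have pow: "?M ^\<^sub>m k * ?Y = scalar_mat n ((c - d) ^ k) * ?Y" for k
  proof (induction k)
    case (Suc k)
    have "?M ^\<^sub>m Suc k * ?Y = ?M ^\<^sub>m k * (?M * ?Y)"
      using assoc_mult_mat[OF pow_carrier_mat[OF M] M Y] by simp
    also have "\<dots> = ?M ^\<^sub>m k * scalar_mat n (c - d) * ?Y"
      using assoc_mult_mat[OF pow_carrier_mat[OF M] scalar_mat_carrier Y] Suc.prems by simp
    also have "\<dots> = scalar_mat n (c - d) * (?M ^\<^sub>m k * ?Y)"
      unfolding scalar_mat_commute[OF pow_carrier_mat[OF M]]
      by (rule assoc_mult_mat[OF scalar_mat_carrier pow_carrier_mat[OF M] Y])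
    also have "\<dots> = scalar_mat n ((c - d) ^ Suc k) * ?Y"
      unfolding Suc.IH[OF Suc.prems] power_Suc scalar_mat_mult
      by (rule assoc_mult_mat[OF scalar_mat_carrier scalar_mat_carrier Y, symmetric])
    finally show ?case .
  qed (use M Y in simp)
  have "0\<^sub>m n n = scalar_mat n ((c - d) ^ j) * ?Y"
    by (simp only: pow[of j, symmetric] assms(4) left_mult_zero_mat[OF Y])
  also have "\<dots> = cval ((c - d) ^ j) \<cdot>\<^sub>m ?Y"
    by (rule scalar_mat_mult_left[OF Y])
  finally have zero: "cval ((c - d) ^ j) \<cdot>\<^sub>m ?Y = 0\<^sub>m n n" ..
  have "?Y = 0\<^sub>m n n"
  proof (rule eq_matI)
    fix i j' assume ij: "i < dim_row (0\<^sub>m n n :: 'a mat)" "j' < dim_col (0\<^sub>m n n :: 'a mat)"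
    then have "cval ((c - d) ^ j) * ?Y $$ (i, j') = 0"
      using arg_cong[OF zero, of "\<lambda>Z. Z $$ (i, j')"] Y by simp
    then show "?Y $$ (i, j') = 0\<^sub>m n n $$ (i, j')"
      using \<open>c \<noteq> d\<close> ij by (simp del: cval_power)
  qed (use Y in auto)
  then show False using nz by blast
qed

section \<open>Polynomial families of matrices with one central eigenvalue\<close>

definition polyfun_mat :: "nat \<Rightarrow> (nat \<Rightarrow> 'a::division_ring mat) \<Rightarrow> bool" where
  "polyfun_mat n F \<longleftrightarrow>
     (\<forall>k. F k \<in> carrier_mat n n) \<and> (\<forall>i<n. \<forall>j<n. polyfun (\<lambda>k. F k $$ (i, j)))"

lemma polyfun_mat_carrier: "polyfun_mat n F \<Longrightarrow> F k \<in> carrier_mat n n"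
  by (simp add: polyfun_mat_def)

lemma polyfun_mat_const: "A \<in> carrier_mat n n \<Longrightarrow> polyfun_mat n (\<lambda>k. A)"
  by (simp add: polyfun_mat_def)

lemma polyfun_mat_mult:
  fixes F G :: "nat \<Rightarrow> 'a::{division_ring, ring_char_0} mat"
  assumes "polyfun_mat n F" "polyfun_mat n G"
  shows "polyfun_mat n (\<lambda>k. F k * G k)"
proof -
  have "(F k * G k) $$ (i, j) = (\<Sum>l\<in>{0..<n}. F k $$ (i, l) * G k $$ (l, j))" if "i < n" "j < n" for i j k
    using that polyfun_mat_carrier[OF assms(1), of k] polyfun_mat_carrier[OF assms(2), of k]
    by (auto simp: scalar_prod_def)
  moreover have "F k * G k \<in> carrier_mat n n" for k
    by (rule mult_carrier_mat[OF polyfun_mat_carrier[OF assms(1)] polyfun_mat_carrier[OF assms(2)]])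
  ultimately show ?thesis
    using assms by (auto simp: polyfun_mat_def intro!: polyfun_sum polyfun_mult)
qed

lemma polyfun_mat_diff:
  assumes "polyfun_mat n F" "polyfun_mat n G"
  shows "polyfun_mat n (\<lambda>k. F k - G k)"
proof -
  have "(F k - G k) $$ (i, j) = F k $$ (i, j) - G k $$ (i, j)" if "i < n" "j < n" for i j k
    using that polyfun_mat_carrier[OF assms(2), of k] by auto
  then show ?thesis
    using assms by (auto simp: polyfun_mat_def intro!: polyfun_diff minus_carrier_mat)
qed

lemma polyfun_mat_power:
  fixes F :: "nat \<Rightarrow> 'a::{division_ring, ring_char_0} mat"
  assumes "polyfun_mat n F"
  shows "polyfun_mat n (\<lambda>k. F k ^\<^sub>m j)"
proof (induction j)
  case 0
  have "F k ^\<^sub>m 0 = 1\<^sub>m n" for k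
    using polyfun_mat_carrier[OF assms, of k] by simp
  then show ?case by (simp add: polyfun_mat_const)
next
  case (Suc j)
  then show ?case using polyfun_mat_mult[OF Suc assms] by simp
qed

lemma polyfun_mat_eq_0_if_infinite_zeros:
  fixes F :: "nat \<Rightarrow> 'a::{division_ring, ring_char_0} mat"
  assumes "polyfun_mat n F" "infinite K" "\<And>k. k \<in> K \<Longrightarrow> F k = 0\<^sub>m n n"
  shows "F k = 0\<^sub>m n n"
proof (rule eq_matI)
  fix i j assume "i < dim_row (0\<^sub>m n n :: 'a mat)" "j < dim_col (0\<^sub>m n n :: 'a mat)"
  then have ij: "i < n" "j < n" by auto
  then have "polyfun (\<lambda>k. F k $$ (i, j))" using assms(1) by (simp add: polyfun_mat_def)
  then have "F k $$ (i, j) = 0"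
    using assms(2) by (rule polyfun_eq_0_if_infinite_zeros) (use assms(3) ij in auto)
  then show "F k $$ (i, j) = 0\<^sub>m n n $$ (i, j)" using ij by simp
qed (use polyfun_mat_carrier[OF assms(1), of k] in auto)

text \<open>With \<open>A = I + N\<close>, the difference in \<open>k\<close> of
  \<open>A^k * N^l\<close> is \<open>A^k * N^(l+1)\<close>. Starting from \<open>N^m = 0\<close>,
  each step takes an antidifference and lowers \<open>l\<close>, until \<open>l = 0\<close>.\<close>

lemma polyfun_mat_unipotent_power:
  fixes N :: "'a::{division_ring, ring_char_0} mat"
  assumes "N \<in> carrier_mat n n" "N ^\<^sub>m m = 0\<^sub>m n n"
  shows "polyfun_mat n (\<lambda>k. (1\<^sub>m n + N) ^\<^sub>m k)"
proof -
  let ?A = "1\<^sub>m n + N"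
  have A: "?A \<in> carrier_mat n n" using assms(1) by simp
  have "polyfun_mat n (\<lambda>k. ?A ^\<^sub>m k * N ^\<^sub>m (m - i))" if "i \<le> m" for i
    using that
  proof (induction i)
    case 0
    have "?A ^\<^sub>m k * N ^\<^sub>m m = 0\<^sub>m n n" for k
      unfolding assms(2) by (rule right_mult_zero_mat[OF pow_carrier_mat[OF A]])
    then show ?case by (simp add: polyfun_mat_const)
  next
    case (Suc i)
    define l where "l = m - Suc i"
    have l: "Suc l = m - i" using Suc.prems by (simp add: l_def)
    have Nl: "N ^\<^sub>m l \<in> carrier_mat n n" "N ^\<^sub>m Suc l \<in> carrier_mat n n" using assms(1) by auto
    have step: "?A ^\<^sub>m Suc k * N ^\<^sub>m l = ?A ^\<^sub>m k * N ^\<^sub>m l + ?A ^\<^sub>m k * N ^\<^sub>m Suc l" for k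
    proof -
      have "?A * N ^\<^sub>m l = N ^\<^sub>m l + N ^\<^sub>m Suc l"
        by (simp only: pow_mat_Suc_left[OF assms(1)] left_mult_one_mat[OF Nl(1)]
            add_mult_distrib_mat[OF one_carrier_mat assms(1) Nl(1)])
      then have "?A ^\<^sub>m Suc k * N ^\<^sub>m l = ?A ^\<^sub>m k * (N ^\<^sub>m l + N ^\<^sub>m Suc l)"
        using assoc_mult_mat[OF pow_carrier_mat[OF A] A Nl(1)] by simp
      then show ?thesis
        using mult_add_distrib_mat[OF pow_carrier_mat[OF A] Nl] by simp
    qed
    have "polyfun_mat n (\<lambda>k. ?A ^\<^sub>m k * N ^\<^sub>m l)"
      unfolding polyfun_mat_def
    proof (intro conjI allI impI)
      show "?A ^\<^sub>m k * N ^\<^sub>m l \<in> carrier_mat n n" for k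
        by (rule mult_carrier_mat[OF pow_carrier_mat[OF A] Nl(1)])
      fix a b assume ab: "a < n" "b < n"
      have "polyfun_mat n (\<lambda>k. ?A ^\<^sub>m k * N ^\<^sub>m Suc l)"
        unfolding l using Suc by simp
      then have "polyfun (\<lambda>k. (?A ^\<^sub>m k * N ^\<^sub>m Suc l) $$ (a, b))"
        using ab by (simp add: polyfun_mat_def)
      then show "polyfun (\<lambda>k. (?A ^\<^sub>m k * N ^\<^sub>m l) $$ (a, b))"
      proof (rule polyfun_antidifference)
        fix k
        have "?A ^\<^sub>m k * N ^\<^sub>m Suc l \<in> carrier_mat n n"
          by (rule mult_carrier_mat[OF pow_carrier_mat[OF A] Nl(2)])
        then show "(?A ^\<^sub>m Suc k * N ^\<^sub>m l) $$ (a, b)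
            = (?A ^\<^sub>m k * N ^\<^sub>m l) $$ (a, b) + (?A ^\<^sub>m k * N ^\<^sub>m Suc l) $$ (a, b)"
          unfolding step using ab by (intro index_add_mat(1)) auto
      qed
    qed
    then show ?case by (simp add: l_def)
  qed
  from this[of m] have "polyfun_mat n (\<lambda>k. ?A ^\<^sub>m k * 1\<^sub>m n)"
    using assms(1) by simp
  then show ?thesis
    using right_mult_one_mat[OF pow_carrier_mat[OF A]] by simp
qed

text \<open>With \<open>E\<close> the shift of the index \<open>l\<close>, the hypothesis says that
  row \<open>Suc i\<close> of \<sigma> is \<open>E - r\<close> applied to row \<open>i\<close>.
  Hence row \<open>i\<close> is \<open>(E - r)^i\<close> applied to row \<open>0\<close>, which is
  then expanded in powers of \<open>E\<close>.\<close>

lemma shifted_recurrence_expansion: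
  fixes \<sigma> :: "nat \<Rightarrow> nat \<Rightarrow> 'b::comm_ring_1"
  assumes "\<And>i l. \<sigma> (Suc i) l = \<sigma> i (Suc l) - r * \<sigma> i l"
  shows "\<sigma> i l = (\<Sum>j\<le>i. coeff ([:- r, 1:] ^ i) j * \<sigma> 0 (l + j))"
proof (induction i arbitrary: l)
  case (Suc i)
  let ?q = "[:- r, 1:] ^ i"
  have deg: "coeff ?q (Suc i) = 0"
    by (rule coeff_eq_0) (metis degree_linear_power lessI)
  have c0: "coeff ([:- r, 1:] * ?q) 0 = - r * coeff ?q 0"
    by (simp add: coeff_mult_0)
  have cS: "coeff ([:- r, 1:] * ?q) (Suc j) = coeff ?q j - r * coeff ?q (Suc j)" for j
    by simp
  have "(\<Sum>j\<le>Suc i. coeff ([:- r, 1:] ^ Suc i) j * \<sigma> 0 (l + j))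
      = - r * coeff ?q 0 * \<sigma> 0 l + (\<Sum>j\<le>i. (coeff ?q j - r * coeff ?q (Suc j)) * \<sigma> 0 (l + Suc j))"
    unfolding power_Suc sum.atMost_Suc_shift c0 cS by simp
  also have "\<dots> = (\<Sum>j\<le>i. coeff ?q j * \<sigma> 0 (Suc l + j))
      - r * (coeff ?q 0 * \<sigma> 0 l + (\<Sum>j\<le>i. coeff ?q (Suc j) * \<sigma> 0 (l + Suc j)))"
    by (simp add: left_diff_distrib right_diff_distrib sum_subtractf sum_distrib_left distrib_left mult.assoc)
  also have "coeff ?q 0 * \<sigma> 0 l + (\<Sum>j\<le>i. coeff ?q (Suc j) * \<sigma> 0 (l + Suc j))
      = (\<Sum>j\<le>Suc i. coeff ?q j * \<sigma> 0 (l + j))"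
    unfolding sum.atMost_Suc_shift by simp
  also have "\<dots> = (\<Sum>j\<le>i. coeff ?q j * \<sigma> 0 (l + j))"
    using deg by simp
  finally show ?case
    by (simp add: assms Suc[of l] Suc[of "Suc l"])
qed simp

text \<open>This is an entry of \<open>(R - r)^m * R^l = 0\<close> expanded in powers of
  \<open>R\<close>. Since \<open>r\<close> is central, \<psi> carries the relation to a commutative
  field; varying \<open>l\<close> yields enough equations for Cramer's rule.\<close>

lemma nilpotent_shift_relation:
  fixes R :: "'a::division_ring mat"
  assumes R: "R \<in> carrier_mat n n" and nil: "(R - scalar_mat n r) ^\<^sub>m m = 0\<^sub>m n n"
    and \<psi>: "center_linear \<psi>" and ab: "a < n" "b < n"
  shows "(\<Sum>j\<le>m. coeff ([:- r, 1:] ^ m) j * \<psi> ((R ^\<^sub>m (l + j)) $$ (a, b))) = 0"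
proof -
  let ?N = "R - scalar_mat n r"
  have N: "?N \<in> carrier_mat n n" using R by auto
  define \<sigma> where "\<sigma> i l = \<psi> ((?N ^\<^sub>m i * R ^\<^sub>m l) $$ (a, b))" for i l
  have entry: "(W - c \<cdot>\<^sub>m Z) $$ (a, b) = W $$ (a, b) - c * Z $$ (a, b)" if "Z \<in> carrier_mat n n" for W Z c
    using that ab by simp
  have step: "\<sigma> (Suc i) l = \<sigma> i (Suc l) - r * \<sigma> i l" for i l
  proof -
    have Rl: "R ^\<^sub>m l \<in> carrier_mat n n" "R ^\<^sub>m Suc l \<in> carrier_mat n n"
      and Ni: "?N ^\<^sub>m i \<in> carrier_mat n n" using R N by auto
    have "?N * R ^\<^sub>m l = R ^\<^sub>m Suc l - scalar_mat n r * R ^\<^sub>m l"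
      unfolding pow_mat_Suc_left[OF R] by (rule minus_mult_distrib_mat[OF R scalar_mat_carrier Rl(1)])
    then have "?N ^\<^sub>m Suc i * R ^\<^sub>m l = ?N ^\<^sub>m i * (R ^\<^sub>m Suc l - scalar_mat n r * R ^\<^sub>m l)"
      using assoc_mult_mat[OF Ni N Rl(1)] by simp
    also have "\<dots> = ?N ^\<^sub>m i * R ^\<^sub>m Suc l - ?N ^\<^sub>m i * (scalar_mat n r * R ^\<^sub>m l)"
      by (rule mult_minus_distrib_mat[OF Ni Rl(2) mult_carrier_mat[OF scalar_mat_carrier Rl(1)]])
    also have "?N ^\<^sub>m i * (scalar_mat n r * R ^\<^sub>m l) = scalar_mat n r * (?N ^\<^sub>m i * R ^\<^sub>m l)"
      using assoc_mult_mat[OF Ni scalar_mat_carrier Rl(1)]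
        assoc_mult_mat[OF scalar_mat_carrier Ni Rl(1)] scalar_mat_commute[OF Ni] by metis
    also have "\<dots> = cval r \<cdot>\<^sub>m (?N ^\<^sub>m i * R ^\<^sub>m l)"
      by (rule scalar_mat_mult_left[OF mult_carrier_mat[OF Ni Rl(1)]])
    finally have "(?N ^\<^sub>m Suc i * R ^\<^sub>m l) $$ (a, b)
        = (?N ^\<^sub>m i * R ^\<^sub>m Suc l) $$ (a, b) - cval r * (?N ^\<^sub>m i * R ^\<^sub>m l) $$ (a, b)"
      using entry mult_carrier_mat[OF Ni Rl(1)] by metis
    then show ?thesis
      using \<psi> unfolding \<sigma>_def center_linear_diff[OF \<psi>, symmetric] by (simp add: center_linear_diff center_linear_def)
  qed
  have "\<sigma> 0 l = \<psi> ((R ^\<^sub>m l) $$ (a, b))" for l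
    using R N left_mult_one_mat[OF pow_carrier_mat[OF R]] by (simp add: \<sigma>_def)
  moreover have "\<sigma> m l = 0"
    using left_mult_zero_mat[OF pow_carrier_mat[OF R, of l]] ab \<psi> unfolding \<sigma>_def nil by simp
  ultimately show ?thesis
    using shifted_recurrence_expansion[of \<sigma> r m l, OF step] by simp
qed

section \<open>The eigenvalue as a rational function of the parameter\<close>

lemma polyfun_mat_power_entry:
  fixes R :: "nat \<Rightarrow> 'a::{division_ring, ring_char_0} mat"
  assumes "polyfun_mat n R" "center_linear \<psi>" "a < n" "b < n"
  obtains s where "\<And>j k. \<psi> ((R k ^\<^sub>m j) $$ (a, b)) = poly (s j) (of_nat k)"
proof -
  have "\<exists>p. \<forall>k. \<psi> ((R k ^\<^sub>m j) $$ (a, b)) = poly p (of_nat k)" for j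
    using polyfun_mat_power[OF assms(1), of j] assms(2-4)
    by (intro polyfun_center_linear) (auto simp: polyfun_mat_def)
  then show thesis using that by metis
qed

lemma coeff_shift_power:
  "coeff ([:- r, 1:] ^ m) m = (1 :: 'b::comm_ring_1)"
  "0 < m \<Longrightarrow> coeff ([:- r, 1:] ^ m) (m - 1) = - of_nat m * (r :: 'b::comm_ring_1)"
  by (simp_all add: coeff_linear_poly_power) (cases m; simp)

text \<open>The numbers \<open>s j k = \<psi> ((R k)^j)\<close>, where \<open>\<psi>\<close> also selects a matrix entry, satisfy the linear
  recurrence with characteristic polynomial \<open>(x - r k)^m\<close>, whose next-to-leading coefficient is
  \<open>- m * r k\<close>. The square system for the coefficients has a matrix of Hankel type, with rows
  reversed to make it triangular at \<open>k0\<close>; Cramer's rule solves it over the polynomial ring.\<close>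

lemma eigenvalue_rational:
  fixes R :: "nat \<Rightarrow> 'a::{division_ring, ring_char_0} mat"
  assumes poly: "polyfun_mat n R" and nil: "\<And>k. (R k - scalar_mat n (r k)) ^\<^sub>m m = 0\<^sub>m n n"
    and k0: "r k0 = 0" "R k0 ^\<^sub>m (m - 1) \<noteq> 0\<^sub>m n n" and m: "0 < m"
  shows "\<exists>p q. poly q (of_nat k0) \<noteq> 0 \<and> (\<forall>k. poly q (of_nat k) * r k = poly p (of_nat k))"
proof -
  have carrier: "R k \<in> carrier_mat n n" for k by (rule polyfun_mat_carrier[OF poly])
  obtain a b where ab: "a < n" "b < n" "(R k0 ^\<^sub>m (m - 1)) $$ (a, b) \<noteq> 0"
    using k0(2) pow_carrier_mat[OF carrier, of k0 "m - 1"]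
    by (metis (no_types, lifting) carrier_matD eq_matI index_zero_mat)
  obtain \<psi> where \<psi>: "center_linear \<psi>" "\<psi> ((R k0 ^\<^sub>m (m - 1)) $$ (a, b)) = 1"
    using center_linear_exists[OF ab(3)] by blast
  obtain s where s: "\<And>j k. \<psi> ((R k ^\<^sub>m j) $$ (a, b)) = poly (s j) (of_nat k)"
    using polyfun_mat_power_entry[OF poly \<psi>(1) ab(1,2)] by blast
  define c where "c k j = coeff ([:- r k, 1:] ^ m) j" for k j
  have rel: "(\<Sum>j\<le>m. c k j * poly (s (l + j)) (of_nat k)) = 0" for k l
    using nilpotent_shift_relation[OF carrier nil \<psi>(1) ab(1,2), of k l] by (simp add: c_def s)
  define H where "H = mat m m (\<lambda>(i, j). s (m - 1 - i + j))"
  have H: "H \<in> carrier_mat m m" by (simp add: H_def)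
  \<comment> \<open>The last row of the adjugate eliminates every unknown coefficient except that of
    index \<open>m - 1\<close>, the one that reveals \<open>r k\<close>.\<close>
  define u where "u i = adj_mat H $$ (m - 1, i)" for i
  define q where "q = det H"
  have adj: "(\<Sum>i\<in>{0..<m}. u i * s (m - 1 - i + j)) = (if j = m - 1 then q else 0)" if "j < m" for j
  proof -
    have "(adj_mat H * H) $$ (m - 1, j) = (\<Sum>i\<in>{0..<m}. u i * s (m - 1 - i + j))"
      using H adj_mat(1)[OF H] m that by (auto simp: scalar_prod_def u_def H_def)
    then show ?thesis
      using m that unfolding adj_mat(3)[OF H] by (auto simp: q_def)
  qed
  define p where "p = smult (inverse (of_nat m)) (\<Sum>i\<in>{0..<m}. u i * s (m - 1 - i + m))"
  have "poly q (of_nat k) * r k = poly p (of_nat k)" for k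
  proof -
    let ?e = "\<lambda>p. poly p (of_nat k)"
    have "0 = (\<Sum>i\<in>{0..<m}. ?e (u i) * (\<Sum>j\<le>m. c k j * ?e (s (m - 1 - i + j))))"
      by (simp only: rel) simp
    also have "\<dots> = (\<Sum>i\<in>{0..<m}. \<Sum>j\<le>m. c k j * ?e (u i * s (m - 1 - i + j)))"
      by (simp add: sum_distrib_left mult.left_commute)
    also have "\<dots> = (\<Sum>j\<le>m. \<Sum>i\<in>{0..<m}. c k j * ?e (u i * s (m - 1 - i + j)))"
      by (rule sum.swap)
    also have "\<dots> = (\<Sum>j\<le>m. c k j * ?e (\<Sum>i\<in>{0..<m}. u i * s (m - 1 - i + j)))"
      by (simp add: sum_distrib_left poly_sum)
    also have "\<dots> = c k m * ?e (\<Sum>i\<in>{0..<m}. u i * s (m - 1 - i + m))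
        + (\<Sum>j<m. c k j * ?e (\<Sum>i\<in>{0..<m}. u i * s (m - 1 - i + j)))"
      by (simp add: lessThan_Suc_atMost[symmetric] add.commute)
    also have "(\<Sum>j<m. c k j * ?e (\<Sum>i\<in>{0..<m}. u i * s (m - 1 - i + j)))
        = (\<Sum>j<m. if j = m - 1 then c k j * ?e q else 0)"
    proof (rule sum.cong[OF refl])
      fix j assume "j \<in> {..<m}"
      then have "j < m" by simp
      show "c k j * ?e (\<Sum>i\<in>{0..<m}. u i * s (m - 1 - i + j)) = (if j = m - 1 then c k j * ?e q else 0)"
        unfolding adj[OF \<open>j < m\<close>] by simp
    qed
    also have "\<dots> = c k (m - 1) * ?e q"
      using m by simp
    also have "?e (\<Sum>i\<in>{0..<m}. u i * s (m - 1 - i + m)) = of_nat m * ?e p"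
      using m by (simp add: p_def)
    also have "c k m = 1" unfolding c_def by (rule coeff_shift_power)
    also have "c k (m - 1) = - of_nat m * r k" unfolding c_def using m by (rule coeff_shift_power)
    finally have "of_nat m * (?e q * r k) = of_nat m * ?e p"
      by (auto simp: mult_ac)
    then show ?thesis
      using m by (metis mult_left_cancel neq0_conv of_nat_eq_0_iff)
  qed
  moreover have "poly q (of_nat k0) \<noteq> 0"
  proof -
    let ?e = "\<lambda>p. poly p (of_nat k0 :: 'a center)"
    interpret e: comm_ring_hom ?e by unfold_locales auto
    let ?H = "map_mat ?e H"
    \<comment> \<open>As \<open>r k0 = 0\<close>, the \<open>m\<close>-th power of
      \<open>R k0\<close> itself is zero. So the entries of \<open>H\<close> above the diagonal
      vanish at \<open>k0\<close>, while each diagonal entry \<open>s (m - 1)\<close> has the value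
      1 there.\<close>
    have zero: "?e (s j) = 0" if "m \<le> j" for j
    proof -
      have "R k0 - scalar_mat n (r k0) = R k0"
        using carrier[of k0] by (intro eq_matI) (auto simp: k0(1))
      then have "R k0 ^\<^sub>m j = 0\<^sub>m n n"
        using pow_mat_zero_mono[OF carrier _ that] nil[of k0] by simp
      then show ?thesis using ab \<psi>(1) by (simp add: s[symmetric])
    qed
    have "det ?H = prod_list (diag_mat ?H)"
      using H by (intro det_lower_triangular[of m]) (auto simp: H_def intro!: zero)
    also have "\<dots> = (\<Prod>i = 0..<m. ?e (s (m - 1)))"
      unfolding prod_list_diag_prod using H by (intro prod.cong) (auto simp: H_def)
    also have "\<dots> = 1"
      using \<psi>(2) by (simp add: s)
    finally show ?thesis by (simp add: q_def)
  qed
  ultimately show ?thesis by blast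
qed

text \<open>As in the rational root theorem: multiplied by \<open>q^m\<close>, the relation becomes
  a polynomial identity in which every term with \<open>j \<ge> 1\<close> contains \<open>q\<close>,
  while the term \<open>j = 0\<close> is \<open>(- p)^m * s 0\<close>. The equation for
  \<open>r\<close> is assumed only on \<open>K\<close> because cancelling a common factor loses the
  points where it vanishes.\<close>

lemma eigenvalue_denominator_dvd:
  fixes R :: "nat \<Rightarrow> 'a::{division_ring, ring_char_0} mat"
  assumes poly: "polyfun_mat n R" and nil: "\<And>k. (R k - scalar_mat n (r k)) ^\<^sub>m m = 0\<^sub>m n n"
    and K: "infinite K" "\<And>k. k \<in> K \<Longrightarrow> poly q (of_nat k) * r k = poly p (of_nat k)" and n: "0 < n"
  shows "q dvd p ^ m"
proof -
  have carrier: "R k \<in> carrier_mat n n" for k by (rule polyfun_mat_carrier[OF poly])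
  \<comment> \<open>Normalized at 1 and used with the entry \<open>(0, 0)\<close>, which is 1 in the
    zeroth power, so that \<open>s 0 = 1\<close>.\<close>
  obtain \<psi> where \<psi>: "center_linear \<psi>" "\<psi> (1 :: 'a) = 1"
    using center_linear_exists[of 1] by auto
  obtain s where s: "\<And>j k. \<psi> ((R k ^\<^sub>m j) $$ (0, 0)) = poly (s j) (of_nat k)"
    using polyfun_mat_power_entry[OF poly \<psi>(1) n n] by blast
  define t where "t j = smult (of_nat (m choose j)) ((- p) ^ (m - j) * q ^ j * s j)" for j
  have "(\<Sum>j\<le>m. t j) = 0"
  proof (rule poly_eq_if_infinite_nats[OF K(1)])
    fix k assume k: "k \<in> K"
    let ?e = "\<lambda>p. poly p (of_nat k)"
    have "?e (t j) = ?e q ^ m * (coeff ([:- r k, 1:] ^ m) j * ?e (s (0 + j)))" if "j \<le> m" for j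
    proof -
      have "(- ?e p) ^ (m - j) * ?e q ^ j = (?e q * (- r k)) ^ (m - j) * ?e q ^ j"
        using K(2)[OF k] by simp
      also have "\<dots> = (?e q ^ (m - j) * ?e q ^ j) * (- r k) ^ (m - j)"
        by (simp only: power_mult_distrib mult_ac)
      also have "?e q ^ (m - j) * ?e q ^ j = ?e q ^ m"
        using that by (simp flip: power_add)
      finally show ?thesis
        using that by (simp add: t_def coeff_linear_poly_power mult_ac)
    qed
    then have "(\<Sum>j\<le>m. ?e (t j)) = ?e q ^ m * (\<Sum>j\<le>m. coeff ([:- r k, 1:] ^ m) j * ?e (s (0 + j)))"
      by (simp add: sum_distrib_left)
    also have "\<dots> = 0"
      using nilpotent_shift_relation[OF carrier nil \<psi>(1) n n, of k 0] by (simp add: s)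
    finally show "?e (\<Sum>j\<le>m. t j) = ?e 0" by (simp add: poly_sum)
  qed
  moreover have "(\<Sum>j\<le>m. t j) = t 0 + (\<Sum>j\<in>{1..m}. t j)"
    by (simp add: atMost_atLeast0 sum.atLeast_Suc_atMost)
  moreover have "q dvd (\<Sum>j\<in>{1..m}. t j)"
    by (rule dvd_sum) (auto simp: t_def intro!: dvd_smult dvd_mult2[OF dvd_mult[OF dvd_power]])
  ultimately have "q dvd t 0"
    by (metis add_eq_0_iff2 dvd_minus_iff)
  moreover have "s 0 = 1"
  proof (rule poly_eq_if_infinite_nats[OF K(1)])
    fix k
    show "poly (s 0) (of_nat k) = poly 1 (of_nat k)"
      using s[of k 0] carrier[of k] n \<psi>(2) by simp
  qed
  ultimately have "q dvd (- 1) ^ m * p ^ m" by (simp add: t_def power_minus[of p])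
  then have "q dvd (- 1) ^ m * ((- 1) ^ m * p ^ m)" by (rule dvd_mult)
  then show ?thesis by (simp flip: mult.assoc power_mult_distrib)
qed

text \<open>With \<open>f\<close> the inverse of \<open>e\<close>,
  \<open>Q - f = (P - e) * (- f * Q)\<close>, and the two factors commute, so the
  \<open>m\<close>-th power contains the factor \<open>(P - e)^m\<close>.\<close>

lemma inverse_nilpotent_shift:
  fixes P Q :: "'a::division_ring mat"
  assumes P: "P \<in> carrier_mat n n" and Q: "Q \<in> carrier_mat n n"
    and inv: "P * Q = 1\<^sub>m n" "Q * P = 1\<^sub>m n"
    and nil: "(P - scalar_mat n e) ^\<^sub>m m = 0\<^sub>m n n" and e0: "e \<noteq> 0"
  shows "(Q - scalar_mat n (inverse e)) ^\<^sub>m m = 0\<^sub>m n n"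
proof -
  let ?N = "P - scalar_mat n (e)" and ?f = "inverse (e)"
  let ?s = "scalar_mat n (- ?f)" and ?W = "1\<^sub>m n - scalar_mat n (e) * Q"
  have N: "?N \<in> carrier_mat n n" using P by auto
  have eQ: "scalar_mat n (e) * Q \<in> carrier_mat n n"
    by (rule mult_carrier_mat[OF scalar_mat_carrier Q])
  have Y: "?s * Q \<in> carrier_mat n n" by (rule mult_carrier_mat[OF scalar_mat_carrier Q])
  have NQ: "?N * Q = ?W"
    using minus_mult_distrib_mat[OF P scalar_mat_carrier Q] by (simp add: inv)
  have QN: "Q * ?N = ?W"
    using mult_minus_distrib_mat[OF Q P scalar_mat_carrier] by (simp add: inv scalar_mat_commute[OF Q])
  have "?s * ?W = ?s - ?s * (scalar_mat n (e) * Q)"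
    using mult_minus_distrib_mat[OF scalar_mat_carrier one_carrier_mat eQ]
    by (simp add: right_mult_one_mat[OF scalar_mat_carrier])
  also have "?s * (scalar_mat n (e) * Q) = scalar_mat n (- ?f * e) * Q"
    unfolding scalar_mat_mult by (rule assoc_mult_mat[OF scalar_mat_carrier scalar_mat_carrier Q, symmetric])
  also have "- ?f * e = - 1" using e0 by simp
  also have "?s - scalar_mat n (- 1) * Q = Q - scalar_mat n ?f"
    unfolding scalar_mat_mult_left[OF Q] using Q
    by (intro eq_matI) (auto simp: scalar_mat_def)
  finally have W: "?s * ?W = Q - scalar_mat n ?f" .
  have NY: "?N * (?s * Q) = Q - scalar_mat n ?f"
    unfolding assoc_mult_mat[OF N scalar_mat_carrier Q, symmetric] scalar_mat_commute[OF N]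
      assoc_mult_mat[OF scalar_mat_carrier N Q] NQ W ..
  have YN: "?s * Q * ?N = Q - scalar_mat n ?f"
    unfolding assoc_mult_mat[OF scalar_mat_carrier Q N] QN W ..
  have "(?N * (?s * Q)) ^\<^sub>m m = ?N ^\<^sub>m m * (?s * Q) ^\<^sub>m m"
    using NY YN by (intro pow_mat_mult_distrib[OF N Y]) simp
  then show ?thesis
    unfolding NY nil using left_mult_zero_mat[OF pow_carrier_mat[OF Y]] by simp
qed

lemma eigenvalue_constant:
  fixes P Q :: "nat \<Rightarrow> 'a::{division_ring, ring_char_0} mat"
  assumes P: "polyfun_mat n P" and Q: "polyfun_mat n Q" and n: "0 < n"
    and inv: "\<And>k. P k * Q k = 1\<^sub>m n" "\<And>k. Q k * P k = 1\<^sub>m n"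
    and nil: "\<And>k. (P k - scalar_mat n (e k)) ^\<^sub>m n = 0\<^sub>m n n" and e: "\<And>k. e k \<noteq> 0"
  shows "e k = e 0"
proof -
  have Pc: "P k \<in> carrier_mat n n" and Qc: "Q k \<in> carrier_mat n n" for k
    using P Q by (auto simp: polyfun_mat_def)
  have nil_Q: "(Q k - scalar_mat n (inverse (e k))) ^\<^sub>m n = 0\<^sub>m n n" for k
    by (rule inverse_nilpotent_shift[OF Pc Qc inv nil e])
  let ?nil = "\<lambda>m. \<forall>k. (P k - scalar_mat n (e k)) ^\<^sub>m m = 0\<^sub>m n n"
  \<comment> \<open>The least exponent that works for all \<open>k\<close> at once. Some
    \<open>k0\<close> then needs the full exponent, which makes the denominator in
    \<open>eigenvalue_rational\<close> nonzero at \<open>k0\<close>.\<close>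
  define m where "m = (LEAST m. ?nil m)"
  have "?nil n" using nil by blast
  then have m: "?nil m" unfolding m_def by (rule LeastI)
  have "0 < m"
  proof (rule ccontr)
    assume "\<not> 0 < m"
    then have "(1\<^sub>m n :: 'a mat) = 0\<^sub>m n n"
      using m Pc[of 0] by simp
    then show False using n by (metis index_one_mat(1) index_zero_mat(1) zero_neq_one)
  qed
  then have "\<not> ?nil (m - 1)"
    using not_less_Least[of "m - 1" ?nil] by (simp add: m_def)
  then obtain k0 where k0: "(P k0 - scalar_mat n (e k0)) ^\<^sub>m (m - 1) \<noteq> 0\<^sub>m n n" by blast
  \<comment> \<open>The shift by \<open>e k0\<close> moves the eigenvalue at \<open>k0\<close> to
    zero, as \<open>eigenvalue_rational\<close> requires.\<close>
  define R where "R k = P k - scalar_mat n (e k0)" for k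
  have R: "polyfun_mat n R"
    unfolding R_def by (rule polyfun_mat_diff[OF P polyfun_mat_const[OF scalar_mat_carrier]])
  have "R k - scalar_mat n (e k - e k0) = P k - scalar_mat n (e k)" for k
    using Pc[of k] by (intro eq_matI) (auto simp: R_def scalar_mat_def)
  then obtain p q where pq: "poly q (of_nat k0) \<noteq> 0"
    "\<And>k. poly q (of_nat k) * (e k - e k0) = poly p (of_nat k)"
    using eigenvalue_rational[OF R, of "\<lambda>k. e k - e k0" m k0] m k0 \<open>0 < m\<close> by (auto simp: R_def)
  define p1 where "p1 = p + smult (e k0) q"
  have p1: "poly q (of_nat k) * e k = poly p1 (of_nat k)" for k
    using pq(2)[of k] by (simp add: p1_def algebra_simps)
  have "q \<noteq> 0" using pq(1) by auto
  define g where "g = gcd p1 q"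
  have "g \<noteq> 0" using \<open>q \<noteq> 0\<close> by (simp add: g_def)
  then obtain p' q' where pq': "p1 = p' * g" "q = q' * g" "coprime p' q'"
    using gcd_coprime_exists[of p1 q] unfolding g_def by blast
  \<comment> \<open>Off the finitely many zeros of \<open>g\<close>, this common factor can be
    cancelled from \<open>q * e = p1\<close>.\<close>
  define K where "K = {k :: nat. poly g (of_nat k) \<noteq> 0}"
  have K: "infinite K"
  proof
    assume "finite K"
    then have "infinite (- K)" by (metis finite_compl infinite_UNIV_nat)
    then have "g = 0" by (rule poly_eq_if_infinite_nats) (simp add: K_def)
    with \<open>g \<noteq> 0\<close> show False by simp
  qed
  have eK: "poly q' (of_nat k) * e k = poly p' (of_nat k)" if "k \<in> K" for k
    using p1[of k] that by (simp add: pq'(1,2) K_def mult_ac)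
  have "q' dvd p' ^ n"
    by (rule eigenvalue_denominator_dvd[OF P nil K eK n])
  moreover have "p' dvd q' ^ n"
  proof (rule eigenvalue_denominator_dvd[OF Q nil_Q K _ n])
    show "poly p' (of_nat k) * inverse (e k) = poly q' (of_nat k)" if "k \<in> K" for k
      using e[of k] by (simp add: eK[OF that, symmetric])
  qed
  moreover have "coprime q' (p' ^ n)" "coprime p' (q' ^ n)"
    using pq'(3) by (auto simp: coprime_commute)
  ultimately have "is_unit q'" "is_unit p'"
    by (simp_all only: coprime_absorb_left)
  then obtain a b where ab: "q' = [:b:]" "p' = [:a:]" "b \<noteq> 0"
    by (auto simp: is_unit_poly_iff dvd_field_iff)
  \<comment> \<open>So far \<open>e k = a / b\<close> only for \<open>k\<close> in \<open>K\<close>,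
    which may miss 0. Nilpotency after subtracting the fixed scalar \<open>a / b\<close> is a
    polynomial condition in \<open>k\<close>, so it extends to all \<open>k\<close>, and uniqueness
    of the eigenvalue applies.\<close>
  have "polyfun_mat n (\<lambda>k. (P k - scalar_mat n (a / b)) ^\<^sub>m n)"
    by (intro polyfun_mat_power polyfun_mat_diff[OF P polyfun_mat_const[OF scalar_mat_carrier]])
  then have "(P k - scalar_mat n (a / b)) ^\<^sub>m n = 0\<^sub>m n n" for k
    using K
  proof (rule polyfun_mat_eq_0_if_infinite_zeros)
    fix k assume "k \<in> K"
    then have "e k = a / b" using eK[of k] ab by (simp add: field_simps)
    then show "(P k - scalar_mat n (a / b)) ^\<^sub>m n = 0\<^sub>m n n" using nil[of k] by simp
  qed
  then have "e k = a / b" for k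
    by (rule nilpotent_shift_unique[OF Pc n nil])
  then show ?thesis by simp
qed

section \<open>Nilpotent matrices up to a central scalar\<close>

lemma mult_mat_zero_vec:
  "A \<in> carrier_mat n m \<Longrightarrow> A *\<^sub>v 0\<^sub>v m = (0\<^sub>v n :: 'a::ring_1 vec)"
  by (intro eq_vecI) auto

lemma mat_eq_0_if_kills_vectors:
  fixes A :: "'a::ring_1 mat"
  assumes "A \<in> carrier_mat n m" "\<And>v. v \<in> carrier_vec m \<Longrightarrow> A *\<^sub>v v = 0\<^sub>v n"
  shows "A = 0\<^sub>m n m"
proof (rule eq_matI)
  fix i j assume "i < dim_row (0\<^sub>m n m :: 'a mat)" "j < dim_col (0\<^sub>m n m :: 'a mat)"
  then have ij: "i < n" "j < m" by auto
  have "(A *\<^sub>v unit_vec m j) $ i = A $$ (i, j)"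
    using ij assms(1) by simp
  then show "A $$ (i, j) = 0\<^sub>m n m $$ (i, j)"
    using ij assms(2)[of "unit_vec m j"] by simp
qed (use assms(1) in auto)

text \<open>Once two successive kernels of the powers \<open>N^i\<close> agree, all later ones do,
  and by nilpotency this can only be the whole space. If \<open>N^n\<close> were nonzero, there
  would be \<open>n + 1\<close> strict inclusions in a space of dimension \<open>n\<close>.\<close>

lemma pow_mat_dim_vanishes:
  fixes N :: "'a::division_ring mat"
  assumes N: "N \<in> carrier_mat n n" and nil: "N ^\<^sub>m k = 0\<^sub>m n n"
  shows "N ^\<^sub>m n = 0\<^sub>m n n"
proof (rule ccontr)
  assume nz: "N ^\<^sub>m n \<noteq> 0\<^sub>m n n"
  define V where "V i = {v \<in> carrier_vec n. N ^\<^sub>m i *\<^sub>v v = 0\<^sub>v n}" for i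
  have Ni: "N ^\<^sub>m i \<in> carrier_mat n n" for i using N by simp
  have V_Suc: "v \<in> V (Suc i) \<longleftrightarrow> v \<in> carrier_vec n \<and> N *\<^sub>v v \<in> V i" for v i
    using assoc_mult_mat_vec[OF Ni[of i] N, of v] mult_mat_vec_carrier[OF N, of v]
    by (auto simp: V_def)
  have subspace: "right_subspace n (V i)" for i
    unfolding right_subspace_def
  proof (intro conjI ballI allI)
    show "0\<^sub>v n \<in> V i" using mult_mat_zero_vec[OF Ni] by (simp add: V_def)
    show "v + w \<in> V i" if "v \<in> V i" "w \<in> V i" for v w
      using that mult_add_distrib_mat_vec[OF Ni[of i], of v w] by (auto simp: V_def)
    show "rsmult_vec v c \<in> V i" if "v \<in> V i" for v c
      using that mult_mat_rsmult_vec[OF Ni[of i], of v c]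
      by (auto simp: V_def intro!: eq_vecI)
  qed (auto simp: V_def)
  have mono: "V i \<subseteq> V (Suc i)" for i
  proof (induction i)
    case 0
    have "v \<in> V (Suc 0)" if "v \<in> V 0" for v
    proof -
      have "v = 0\<^sub>v n" using that N by (auto simp: V_def)
      then show ?thesis using subspace[of "Suc 0"] by (auto simp: right_subspace_def)
    qed
    then show ?case by blast
  next
    case (Suc i)
    then show ?case using V_Suc by blast
  qed
  have strict: "V i \<noteq> V (Suc i)" if "i \<le> n" for i
  proof
    assume eq: "V i = V (Suc i)"
    have "V (j + i) = V i" for j
    proof (induction j)
      case (Suc j)
      have "v \<in> V (Suc (j + i)) \<longleftrightarrow> v \<in> V (Suc i)" for v
        unfolding V_Suc Suc ..
      then show ?case using eq by auto
    qed simp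
    then have "V (k + i) = V i" .
    moreover have "N ^\<^sub>m (k + i) = 0\<^sub>m n n"
      by (rule pow_mat_zero_mono[OF N nil]) simp
    then have "V (k + i) = carrier_vec n"
      by (auto simp: V_def)
    ultimately have "N ^\<^sub>m i = 0\<^sub>m n n"
      by (intro mat_eq_0_if_kills_vectors[OF Ni]) (auto simp: V_def)
    then show False
      using pow_mat_zero_mono[OF N _ that] nz by blast
  qed
  have "i \<le> sdim n (V i)" if "i \<le> Suc n" for i
    using that
  proof (induction i)
    case (Suc i)
    then have "sdim n (V i) < sdim n (V (Suc i))"
      using mono[of i] strict[of i] by (intro sdim_strict_mono subspace) auto
    then show ?case using Suc by simp
  qed simp
  from this[of "Suc n"] sdim_le[OF subspace[of "Suc n"]] show False by simp
qed

text \<open>The fixed exponent \<open>n\<close> loses nothing by \<open>pow_mat_dim_vanishes\<close>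
  and gives families one common exponent, as \<open>eigenvalue_constant\<close> demands.\<close>

definition has_eigenvalue :: "nat \<Rightarrow> 'a::division_ring center \<Rightarrow> 'a mat \<Rightarrow> bool" where
  "has_eigenvalue n c A \<longleftrightarrow> A \<in> carrier_mat n n \<and> (A - scalar_mat n c) ^\<^sub>m n = 0\<^sub>m n n"

lemma has_eigenvalueI:
  assumes "A \<in> carrier_mat n n" "(A - scalar_mat n c) ^\<^sub>m k = 0\<^sub>m n n"
  shows "has_eigenvalue n c A"
  using pow_mat_dim_vanishes[OF minus_carrier_mat[OF scalar_mat_carrier] assms(2)] assms(1)
  by (simp add: has_eigenvalue_def)

lemma central_plus_nilpotent_iff:
  "central_plus_nilpotent_mat n A \<longleftrightarrow> (\<exists>c. has_eigenvalue n c A)"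
proof
  assume "central_plus_nilpotent_mat n A"
  then obtain c N k where c: "c \<in> ring_center" and N: "N \<in> carrier_mat n n" "N ^\<^sub>m k = 0\<^sub>m n n"
    and A: "A = c \<cdot>\<^sub>m 1\<^sub>m n + N"
    by (auto simp: central_plus_nilpotent_mat_def nilpotent_mat_def)
  have "A = scalar_mat n (Center c) + N"
    using c by (simp add: A scalar_mat_eq_smult Center_inverse)
  then have "A - scalar_mat n (Center c) = N"
    using N(1) by (intro eq_matI) auto
  then have "has_eigenvalue n (Center c) A"
    using N A by (intro has_eigenvalueI[of _ _ _ k]) auto
  then show "\<exists>c. has_eigenvalue n c A" ..
next
  assume "\<exists>c. has_eigenvalue n c A"
  then obtain c where c: "has_eigenvalue n c A" ..
  have "A = cval c \<cdot>\<^sub>m 1\<^sub>m n + (A - scalar_mat n c)"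
    unfolding scalar_mat_eq_smult[symmetric] using c by (intro eq_matI) (auto simp: has_eigenvalue_def)
  moreover have "nilpotent_mat n (A - scalar_mat n c)"
    using c by (auto simp: has_eigenvalue_def nilpotent_mat_def)
  ultimately show "central_plus_nilpotent_mat n A"
    unfolding central_plus_nilpotent_mat_def using cval[of c] by blast
qed

lemma unipotent_mat_if_has_eigenvalue_1:
  assumes "has_eigenvalue n 1 A"
  shows "unipotent_mat n A"
proof -
  have "A = 1\<^sub>m n + (A - 1\<^sub>m n)"
    using assms by (intro eq_matI) (auto simp: has_eigenvalue_def)
  moreover have "nilpotent_mat n (A - 1\<^sub>m n)"
    using assms minus_carrier_mat[OF one_carrier_mat] by (auto simp: has_eigenvalue_def nilpotent_mat_def)
  ultimately show ?thesis unfolding unipotent_mat_def by blast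
qed

lemma has_eigenvalue_unique: "has_eigenvalue n c A \<Longrightarrow> has_eigenvalue n d A \<Longrightarrow> 0 < n \<Longrightarrow> c = d"
  unfolding has_eigenvalue_def using nilpotent_shift_unique by blast

lemma scalar_mat_mult_vec: "v \<in> carrier_vec n \<Longrightarrow> scalar_mat n c *\<^sub>v v = rsmult_vec v (cval c)"
proof (rule eq_vecI)
  fix i assume v: "v \<in> carrier_vec n" and "i < dim_vec (rsmult_vec v (cval c))"
  then have i: "i < n" by auto
  have "(scalar_mat n c *\<^sub>v v) $ i = (\<Sum>k\<in>{0..<n}. (if i = k then cval c else 0) * v $ k)"
    using i v by (simp add: scalar_prod_def scalar_mat_def)
  also have "\<dots> = (\<Sum>k\<in>{0..<n}. if i = k then cval c * v $ k else 0)"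
    by (rule sum.cong) auto
  finally show "(scalar_mat n c *\<^sub>v v) $ i = rsmult_vec v (cval c) $ i"
    using i v by (simp add: cval_commute)
qed auto

lemma scalar_mat_mult_nilpotent_shift:
  assumes "has_eigenvalue n e A"
  shows "has_eigenvalue n (c * e) (scalar_mat n c * A)"
proof -
  let ?N = "A - scalar_mat n e"
  have A: "A \<in> carrier_mat n n" and N: "?N \<in> carrier_mat n n"
    using assms by (auto simp: has_eigenvalue_def)
  have "scalar_mat n c * A - scalar_mat n (c * e) = scalar_mat n c * ?N"
    unfolding scalar_mat_mult by (rule mult_minus_distrib_mat[OF scalar_mat_carrier A scalar_mat_carrier, symmetric])
  then have "(scalar_mat n c * A - scalar_mat n (c * e)) ^\<^sub>m n = scalar_mat n c ^\<^sub>m n * ?N ^\<^sub>m n"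
    using pow_mat_mult_distrib[OF scalar_mat_carrier N scalar_mat_commute[OF N, symmetric]] by simp
  also have "\<dots> = 0\<^sub>m n n"
    using assms right_mult_zero_mat[OF pow_carrier_mat[OF scalar_mat_carrier]]
    by (simp add: has_eigenvalue_def)
  finally show ?thesis
    using mult_carrier_mat[OF scalar_mat_carrier A] by (intro has_eigenvalueI)
qed

text \<open>If \<open>A\<close> kills \<open>v\<close>, then \<open>N = A - c\<close> satisfies
  \<open>N v = - c v\<close>, hence \<open>0 = N^n v = (- c)^n v\<close>.\<close>

lemma inj_mat_if_has_eigenvalue:
  assumes "has_eigenvalue n c A" "c \<noteq> 0"
  shows "inj_mat A"
proof (rule inj_matI)
  show A: "A \<in> carrier_mat n n" using assms(1) by (simp add: has_eigenvalue_def)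
  fix v assume v: "v \<in> carrier_vec n" and "A *\<^sub>v v = 0\<^sub>v n"
  let ?N = "A - scalar_mat n c"
  have N: "?N \<in> carrier_mat n n" using A by auto
  have "?N *\<^sub>v v = A *\<^sub>v v - scalar_mat n c *\<^sub>v v"
    by (rule minus_mult_distrib_mat_vec[OF A scalar_mat_carrier v])
  also have "\<dots> = rsmult_vec v (- cval c)"
    unfolding \<open>A *\<^sub>v v = 0\<^sub>v n\<close> scalar_mat_mult_vec[OF v] using v by (intro eq_vecI) auto
  finally have Nv: "?N *\<^sub>v v = rsmult_vec v (- cval c)" .
  have "?N ^\<^sub>m k *\<^sub>v v = rsmult_vec v ((- cval c) ^ k)" for k
  proof (induction k)
    case 0
    then show ?case using v by (intro eq_vecI) auto
  next
    case (Suc k)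
    have "?N ^\<^sub>m Suc k *\<^sub>v v = ?N ^\<^sub>m k *\<^sub>v rsmult_vec v (- cval c)"
      using assoc_mult_mat_vec[OF pow_carrier_mat[OF N] N v] by (simp add: Nv)
    also have "\<dots> = rsmult_vec (rsmult_vec v ((- cval c) ^ k)) (- cval c)"
      using mult_mat_rsmult_vec[OF pow_carrier_mat[OF N] v] Suc by simp
    also have "\<dots> = rsmult_vec v ((- cval c) ^ Suc k)"
      by (intro eq_vecI) (simp_all add: mult.assoc power_Suc2 del: power_Suc)
    finally show ?case .
  qed
  from this[of n] have "rsmult_vec v ((- cval c) ^ n) = 0\<^sub>m n n *\<^sub>v v"
    using assms(1) by (simp add: has_eigenvalue_def)
  also have "\<dots> = 0\<^sub>v n" using v by (intro eq_vecI) auto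
  finally have "rsmult_vec v ((- cval c) ^ n) = 0\<^sub>v n" .
  then have "v $ i * (- cval c) ^ n = 0" if "i < n" for i
    using that v by (metis carrier_vecD index_rsmult_vec index_zero_vec(1))
  then show "v = 0\<^sub>v n"
    using v assms(2) by (intro eq_vecI) auto
qed

section \<open>Injectivity of products and of their factors\<close>

lemma inj_mat_mult:
  assumes "inj_mat A" "inj_mat B" "A \<in> carrier_mat n m" "B \<in> carrier_mat m d"
  shows "inj_mat (A * B)"
proof (rule inj_matI[OF mult_carrier_mat[OF assms(3,4)]])
  fix v assume v: "v \<in> carrier_vec d" "A * B *\<^sub>v v = 0\<^sub>v n"
  then have "B *\<^sub>v v = 0\<^sub>v m"
    using assms(3,4) by (intro inj_matD[OF assms(1,3)]) auto
  then show "v = 0\<^sub>v d" by (rule inj_matD[OF assms(2,4) v(1)])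
qed

lemma inj_mat_power:
  assumes "inj_mat A" "A \<in> carrier_mat n n"
  shows "inj_mat (A ^\<^sub>m k)"
proof (induction k)
  case 0
  show ?case using assms(2) by (auto simp: inj_mat_def)
next
  case (Suc k)
  show ?case
    using inj_mat_mult[OF Suc assms(1) pow_carrier_mat[OF assms(2)] assms(2)] by simp
qed

lemma zero_mat_not_inj: "0 < n \<Longrightarrow> \<not> inj_mat (0\<^sub>m n n :: 'a::division_ring mat)"
proof
  assume n: "0 < n" and "inj_mat (0\<^sub>m n n :: 'a mat)"
  moreover have "0\<^sub>m n n *\<^sub>v unit_vec n 0 = (0\<^sub>v n :: 'a vec)"
    by (intro eq_vecI) auto
  ultimately have "unit_vec n 0 = (0\<^sub>v n :: 'a vec)"
    using inj_matD[OF _ zero_carrier_mat unit_vec_carrier] by blast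
  with n show False by simp
qed

text \<open>A right inverse \<open>R\<close> of \<open>A\<close> is injective, hence invertible on
  both sides, and its inverse must be \<open>A\<close>.\<close>

lemma inj_mat_left_factor:
  fixes A B :: "'a::division_ring mat"
  assumes "inj_mat (A * B)" and A: "A \<in> carrier_mat n n" and B: "B \<in> carrier_mat n n"
  shows "inj_mat A"
proof -
  obtain X where X: "X \<in> carrier_mat n n" "A * B * X = 1\<^sub>m n"
    using inj_mat_square_inverse[OF mult_carrier_mat[OF A B] assms(1)] by blast
  define R where "R = B * X"
  have R: "R \<in> carrier_mat n n" "A * R = 1\<^sub>m n"
    using X A B by (auto simp: R_def)
  have "inj_mat R" by (rule inj_mat_if_left_inverse[OF R(1) A R(2)])
  then obtain R' where R': "R' \<in> carrier_mat n n" "R * R' = 1\<^sub>m n" "R' * R = 1\<^sub>m n"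
    using inj_mat_square_inverse[OF R(1)] by blast
  have "A = A * (R * R')" using A by (simp add: R')
  also have "\<dots> = R'" using assoc_mult_mat[OF A R(1) R'(1)] R R' by simp
  finally have "R * A = 1\<^sub>m n" using R'(2) by simp
  then show ?thesis by (rule inj_mat_if_left_inverse[OF A R(1)])
qed

lemma inj_mat_right_factor:
  assumes "inj_mat (A * B)" "A \<in> carrier_mat n n" "B \<in> carrier_mat n n"
  shows "inj_mat B"
proof (rule inj_matI[OF assms(3)])
  fix v assume v: "v \<in> carrier_vec n" "B *\<^sub>v v = 0\<^sub>v n"
  have "A * B *\<^sub>v v = A *\<^sub>v 0\<^sub>v n"
    using assms(2,3) v by simp
  also have "\<dots> = 0\<^sub>v n" using assms(2) by (intro eq_vecI) auto
  finally show "v = 0\<^sub>v n"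
    by (rule inj_matD[OF assms(1) mult_carrier_mat[OF assms(2,3)] v(1)])
qed

lemma has_eigenvalue_0_not_inj:
  assumes "has_eigenvalue n 0 A" "0 < n"
  shows "\<not> inj_mat A"
proof
  assume "inj_mat A"
  have A: "A \<in> carrier_mat n n" using assms(1) by (simp add: has_eigenvalue_def)
  then have "A - scalar_mat n 0 = A" by (intro eq_matI) auto
  then have "A ^\<^sub>m n = 0\<^sub>m n n" using assms(1) by (simp add: has_eigenvalue_def)
  then show False using inj_mat_power[OF \<open>inj_mat A\<close> A, of n] zero_mat_not_inj[OF assms(2), where 'a = 'a] by simp
qed

lemma unipotent_product_has_eigenvalue_1:
  fixes A B :: "'a::{division_ring, ring_char_0} mat"
  assumes A: "has_eigenvalue n 1 A" and B: "has_eigenvalue n 1 B" and n: "0 < n"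
    and powers: "\<And>k. \<exists>e. e \<noteq> 0 \<and> has_eigenvalue n e (A ^\<^sub>m k * B)"
  shows "has_eigenvalue n 1 (A * B)"
proof -
  have carrier: "A \<in> carrier_mat n n" "B \<in> carrier_mat n n"
    using A B by (auto simp: has_eigenvalue_def)
  obtain A' where A': "A' \<in> carrier_mat n n" "A * A' = 1\<^sub>m n" "A' * A = 1\<^sub>m n"
    using inj_mat_square_inverse[OF carrier(1) inj_mat_if_has_eigenvalue[OF A]] by auto
  obtain B' where B': "B' \<in> carrier_mat n n" "B * B' = 1\<^sub>m n" "B' * B = 1\<^sub>m n"
    using inj_mat_square_inverse[OF carrier(2) inj_mat_if_has_eigenvalue[OF B]] by auto
  have poly: "polyfun_mat n (\<lambda>k. X ^\<^sub>m k)"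
    if X: "X \<in> carrier_mat n n" "(X - scalar_mat n 1) ^\<^sub>m n = 0\<^sub>m n n" for X :: "'a mat"
  proof -
    have "1\<^sub>m n + (X - 1\<^sub>m n) = X" using X(1) by (intro eq_matI) auto
    then show ?thesis
      using polyfun_mat_unipotent_power[OF minus_carrier_mat[OF one_carrier_mat], of X n n] X by simp
  qed
  obtain e where e: "\<And>k. e k \<noteq> 0" "\<And>k. has_eigenvalue n (e k) (A ^\<^sub>m k * B)"
    using powers by metis
  let ?P = "\<lambda>k. A ^\<^sub>m k * B" and ?Q = "\<lambda>k. B' * A' ^\<^sub>m k"
  have Ak: "A ^\<^sub>m k \<in> carrier_mat n n" and A'k: "A' ^\<^sub>m k \<in> carrier_mat n n" for k
    using carrier A' by auto
  have one: "(1\<^sub>m n :: 'a mat) ^\<^sub>m k = 1\<^sub>m n" for k by (induction k) auto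
  have "?P k * ?Q k = 1\<^sub>m n" for k
  proof -
    have "?P k * ?Q k = A ^\<^sub>m k * (B * (B' * A' ^\<^sub>m k))"
      by (rule assoc_mult_mat[OF Ak carrier(2) mult_carrier_mat[OF B'(1) A'k]])
    also have "B * (B' * A' ^\<^sub>m k) = A' ^\<^sub>m k"
      using assoc_mult_mat[OF carrier(2) B'(1) A'k, of k] left_mult_one_mat[OF A'k] by (simp add: B'(2))
    also have "A ^\<^sub>m k * A' ^\<^sub>m k = 1\<^sub>m n"
      using pow_mat_mult_distrib[OF carrier(1) A'(1), of k] by (simp add: A' one)
    finally show ?thesis .
  qed
  moreover have "?Q k * ?P k = 1\<^sub>m n" for k
  proof -
    have "?Q k * ?P k = B' * (A' ^\<^sub>m k * (A ^\<^sub>m k * B))"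
      by (rule assoc_mult_mat[OF B'(1) A'k mult_carrier_mat[OF Ak carrier(2)]])
    also have "A' ^\<^sub>m k * (A ^\<^sub>m k * B) = A' ^\<^sub>m k * A ^\<^sub>m k * B"
      by (rule assoc_mult_mat[OF A'k Ak carrier(2), symmetric])
    also have "A' ^\<^sub>m k * A ^\<^sub>m k = 1\<^sub>m n"
      using pow_mat_mult_distrib[OF A'(1) carrier(1), of k] by (simp add: A' one)
    finally show ?thesis using left_mult_one_mat[OF carrier(2)] by (simp add: B'(3))
  qed
  moreover have "polyfun_mat n ?P"
    using A carrier by (intro polyfun_mat_mult poly polyfun_mat_const) (auto simp: has_eigenvalue_def)
  \<comment> \<open>\<open>A'\<close> is unipotent too, by \<open>inverse_nilpotent_shift\<close>
    with \<open>e = 1\<close>, so its powers are polynomial in \<open>k\<close>.\<close>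
  moreover have "polyfun_mat n ?Q"
    using inverse_nilpotent_shift[OF carrier(1) A'(1-3), of 1 n] A
    by (intro polyfun_mat_mult poly polyfun_mat_const A' B') (auto simp: has_eigenvalue_def)
  ultimately have const: "e k = e 0" for k
    using e n by (intro eigenvalue_constant[of n ?P ?Q]) (auto simp: has_eigenvalue_def)
  have "?P 0 = B" "?P 1 = A * B" using carrier by auto
  then show ?thesis
    using e(2)[of 0] e(2)[of 1] const[of 1] has_eigenvalue_unique[OF B _ n, of "e 0"] by simp
qed

section \<open>Invariant subspaces\<close>

definition has_invariant_subspace :: "nat \<Rightarrow> 'a::division_ring mat set \<Rightarrow> bool" where
  "has_invariant_subspace n S \<longleftrightarrow>
     (\<exists>V. right_subspace n V \<and> V \<noteq> {0\<^sub>v n} \<and> V \<noteq> carrier_vec n \<and> (\<forall>A\<in>S. \<forall>v\<in>V. A *\<^sub>v v \<in> V))"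

lemma mat_mult_eq_0_vec:
  fixes A B :: "'a::ring_1 mat"
  assumes "A \<in> carrier_mat n m" "B \<in> carrier_mat m d" "A * B = 0\<^sub>m n d" "v \<in> carrier_vec d"
  shows "A *\<^sub>v (B *\<^sub>v v) = 0\<^sub>v n"
proof -
  have "A *\<^sub>v (B *\<^sub>v v) = 0\<^sub>m n d *\<^sub>v v"
    using assoc_mult_mat_vec[OF assms(1,2,4)] by (simp add: assms(3))
  also have "\<dots> = 0\<^sub>v n" using assms(4) by (intro eq_vecI) auto
  finally show ?thesis .
qed

text \<open>The witness is the largest \<open>S\<close>-invariant subspace of the kernel of
  \<open>A\<close>: proper because \<open>A\<close> is nonzero, and nonzero because it contains the
  range of \<open>A\<close>. The assumption on \<open>A * A\<close> is separate because
  \<open>S\<close> need not contain the identity.\<close>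

lemma has_invariant_subspace_if_annihilated:
  assumes S: "mat_semigroup n S" and A: "A \<in> S" "A \<noteq> 0\<^sub>m n n"
    and AA: "A * A = 0\<^sub>m n n" and ABA: "\<And>B. B \<in> S \<Longrightarrow> A * B * A = 0\<^sub>m n n"
  shows "has_invariant_subspace n (S :: 'a::division_ring mat set)"
proof -
  have carrier: "B \<in> carrier_mat n n" if "B \<in> S" for B
    using S that by (auto simp: mat_semigroup_def)
  have closed: "B * C \<in> S" if "B \<in> S" "C \<in> S" for B C
    using S that by (auto simp: mat_semigroup_def)
  note Ac = carrier[OF A(1)]
  define V where "V = {v \<in> carrier_vec n. A *\<^sub>v v = 0\<^sub>v n \<and> (\<forall>B\<in>S. A *\<^sub>v (B *\<^sub>v v) = 0\<^sub>v n)}"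
  have "right_subspace n V"
    unfolding right_subspace_def
  proof (intro conjI ballI allI)
    show "0\<^sub>v n \<in> V"
      using mult_mat_zero_vec[OF Ac] mult_mat_zero_vec[OF carrier] by (auto simp: V_def)
    show "v + w \<in> V" if "v \<in> V" "w \<in> V" for v w
    proof -
      have vw: "v \<in> carrier_vec n" "w \<in> carrier_vec n" using that by (auto simp: V_def)
      have "A *\<^sub>v (B *\<^sub>v (v + w)) = A *\<^sub>v (B *\<^sub>v v) + A *\<^sub>v (B *\<^sub>v w)" if "B \<in> S" for B
        unfolding mult_add_distrib_mat_vec[OF carrier[OF that] vw]
        using carrier[OF that] vw by (intro mult_add_distrib_mat_vec[OF Ac]) auto
      then show ?thesis
        using that vw mult_add_distrib_mat_vec[OF Ac vw] by (auto simp: V_def)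
    qed
    show "rsmult_vec v c \<in> V" if "v \<in> V" for v c
    proof -
      have v: "v \<in> carrier_vec n" using that by (auto simp: V_def)
      have zero: "rsmult_vec (0\<^sub>v n) c = 0\<^sub>v n" by (intro eq_vecI) auto
      have "A *\<^sub>v (B *\<^sub>v rsmult_vec v c) = rsmult_vec (A *\<^sub>v (B *\<^sub>v v)) c" if "B \<in> S" for B
        unfolding mult_mat_rsmult_vec[OF carrier[OF that] v]
        using carrier[OF that] v by (intro mult_mat_rsmult_vec[OF Ac]) auto
      then show ?thesis
        using that v mult_mat_rsmult_vec[OF Ac v] zero by (auto simp: V_def)
    qed
  qed (auto simp: V_def)
  moreover have "\<exists>u\<in>carrier_vec n. A *\<^sub>v u \<noteq> 0\<^sub>v n"
    using mat_eq_0_if_kills_vectors[OF Ac] A(2) by blast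
  then obtain u where u: "u \<in> carrier_vec n" "A *\<^sub>v u \<noteq> 0\<^sub>v n" by blast
  have "A *\<^sub>v u \<in> V"
  proof -
    have "A *\<^sub>v (B *\<^sub>v (A *\<^sub>v u)) = 0\<^sub>v n" if "B \<in> S" for B
    proof -
      have "A *\<^sub>v u \<in> carrier_vec n" using Ac u(1) by simp
      then show ?thesis
        using mat_mult_eq_0_vec[OF mult_carrier_mat[OF Ac carrier[OF that]] Ac ABA[OF that] u(1)]
          assoc_mult_mat_vec[OF Ac carrier[OF that], of "A *\<^sub>v u"] by simp
    qed
    then show ?thesis
      using mat_mult_eq_0_vec[OF Ac Ac AA u(1)] Ac u(1) by (auto simp: V_def)
  qed
  with u have "V \<noteq> {0\<^sub>v n}" by blast
  moreover have "V \<noteq> carrier_vec n"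
    using u by (auto simp: V_def)
  moreover have "C *\<^sub>v v \<in> V" if C: "C \<in> S" and v: "v \<in> V" for C v
  proof -
    have vc: "v \<in> carrier_vec n" using v by (auto simp: V_def)
    have "A *\<^sub>v (B *\<^sub>v (C *\<^sub>v v)) = 0\<^sub>v n" if B: "B \<in> S" for B
      using v closed[OF B C] assoc_mult_mat_vec[OF carrier[OF B] carrier[OF C] vc]
      by (auto simp: V_def)
    then show ?thesis
      using v C carrier[OF C] vc by (auto simp: V_def)
  qed
  ultimately show ?thesis unfolding has_invariant_subspace_def by blast
qed

text \<open>Each \<open>A v\<close> equals \<open>X (A w)\<close> for some \<open>w\<close>;
  iterating, \<open>A v\<close> lies in the range of \<open>X^k = 0\<close>.\<close>

lemma zero_if_range_stable:
  fixes A X :: "'a::division_ring mat"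
  assumes A: "A \<in> carrier_mat n n" and X: "X \<in> carrier_mat n n" "X ^\<^sub>m k = 0\<^sub>m n n"
    and range: "mat_range A \<subseteq> mat_range (X * A)"
  shows "A = 0\<^sub>m n n"
proof (rule mat_eq_0_if_kills_vectors[OF A])
  fix v :: "'a vec" assume v: "v \<in> carrier_vec n"
  have step: "\<exists>w\<in>carrier_vec n. A *\<^sub>v v = X *\<^sub>v (A *\<^sub>v w)" if "v \<in> carrier_vec n" for v
  proof -
    have "A *\<^sub>v v \<in> mat_range (X * A)" using range A that by (auto simp: mat_range_def)
    then show ?thesis using A X(1) by (auto simp: mat_range_def)
  qed
  have "\<exists>w\<in>carrier_vec n. A *\<^sub>v v = X ^\<^sub>m j *\<^sub>v (A *\<^sub>v w)" for j
  proof (induction j)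
    case 0
    show ?case using A X(1) v by (intro bexI[of _ v]) auto
  next
    case (Suc j)
    then obtain w where w: "w \<in> carrier_vec n" "A *\<^sub>v v = X ^\<^sub>m j *\<^sub>v (A *\<^sub>v w)" by blast
    obtain x where x: "x \<in> carrier_vec n" "A *\<^sub>v w = X *\<^sub>v (A *\<^sub>v x)" using step[OF w(1)] by blast
    have "A *\<^sub>v v = X ^\<^sub>m Suc j *\<^sub>v (A *\<^sub>v x)"
      using assoc_mult_mat_vec[OF pow_carrier_mat[OF X(1)] X(1), of "A *\<^sub>v x" j] A x w(2) by simp
    then show ?case using x(1) by blast
  qed
  from this[of k] obtain w where "w \<in> carrier_vec n" "A *\<^sub>v v = 0\<^sub>m n n *\<^sub>v (A *\<^sub>v w)"
    unfolding X(2) by blast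
  then show "A *\<^sub>v v = 0\<^sub>v n" using A by (auto intro!: eq_vecI)
qed

text \<open>Levitzki's theorem: an element \<open>A\<close> of minimal range among the nonzero nilpotent elements
  satisfies \<open>A * B * A = 0\<close>, since otherwise the nilpotent \<open>A * B\<close> would map the range of \<open>A\<close> onto
  itself.\<close>

lemma has_invariant_subspace_if_nilpotent:
  assumes S: "mat_semigroup n S" "\<forall>A\<in>S. central_plus_nilpotent_mat n A" and n: "0 < n"
    and ex: "\<exists>A\<in>S. A \<noteq> 0\<^sub>m n n \<and> has_eigenvalue n 0 A"
  shows "has_invariant_subspace n (S :: 'a::division_ring mat set)"
proof -
  have carrier: "B \<in> carrier_mat n n" if "B \<in> S" for B
    using S that by (auto simp: mat_semigroup_def)
  have closed: "B * C \<in> S" if "B \<in> S" "C \<in> S" for B C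
    using S that by (auto simp: mat_semigroup_def)
  define J where "J = {A \<in> S. A \<noteq> 0\<^sub>m n n \<and> has_eigenvalue n 0 A}"
  obtain A where A: "A \<in> J" and min: "\<And>B. B \<in> J \<Longrightarrow> sdim n (mat_range A) \<le> sdim n (mat_range B)"
    using ex arg_min_nat_lemma[of "\<lambda>A. A \<in> J" _ "\<lambda>A. sdim n (mat_range A)"] unfolding J_def by blast
  have AS: "A \<in> S" "A \<noteq> 0\<^sub>m n n" and A0: "has_eigenvalue n 0 A" using A by (auto simp: J_def)
  note Ac = carrier[OF AS(1)]
  have not_inj: "\<not> inj_mat A" by (rule has_eigenvalue_0_not_inj[OF A0 n])
  \<comment> \<open>Every element of \<open>S\<close> is injective or nilpotent, so products in
    \<open>S\<close> with the singular factor \<open>A\<close> are again nilpotent.\<close>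
  have eig0: "has_eigenvalue n 0 B" if B: "B \<in> S" "\<not> inj_mat B" for B
  proof -
    obtain c where "has_eigenvalue n c B"
      using S(2) B(1) by (auto simp: central_plus_nilpotent_iff)
    then show ?thesis using inj_mat_if_has_eigenvalue B(2) by (cases "c = 0") auto
  qed
  have nil: "B ^\<^sub>m n = 0\<^sub>m n n" if "has_eigenvalue n 0 B" for B
  proof -
    have "B - scalar_mat n 0 = B"
      using that by (intro eq_matI) (auto simp: has_eigenvalue_def)
    then show ?thesis using that by (simp add: has_eigenvalue_def)
  qed
  \<comment> \<open>Stated for a general \<open>X\<close> because it is applied both to
    \<open>A * B\<close> and to \<open>A\<close> itself.\<close>
  have XA: "X * A = 0\<^sub>m n n" if X: "X \<in> S" "has_eigenvalue n 0 X" "mat_range X \<subseteq> mat_range A" for X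
  proof (rule ccontr)
    assume nz: "X * A \<noteq> 0\<^sub>m n n"
    note Xc = carrier[OF X(1)]
    have "\<not> inj_mat (X * A)"
      using not_inj inj_mat_right_factor[OF _ Xc Ac] by blast
    then have "X * A \<in> J"
      using nz closed[OF X(1) AS(1)] eig0 by (auto simp: J_def)
    then have le: "sdim n (mat_range A) \<le> sdim n (mat_range (X * A))" by (rule min)
    have "mat_range (X * A) \<subseteq> mat_range X"
      using Ac Xc by (auto simp: mat_range_def)
    then have "mat_range (X * A) \<subseteq> mat_range A" using X(3) by blast
    then have "mat_range A = mat_range (X * A)"
      using sdim_strict_mono[OF right_subspace_mat_range right_subspace_mat_range[OF Ac], of "X * A" n] le
        mult_carrier_mat[OF Xc Ac] by fastforce
    then have "A = 0\<^sub>m n n"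
      by (intro zero_if_range_stable[OF Ac Xc nil[OF X(2)]]) simp
    then show False using AS(2) by simp
  qed
  have "A * B * A = 0\<^sub>m n n" if B: "B \<in> S" for B
  proof (rule XA[OF closed[OF AS(1) B] eig0[OF closed[OF AS(1) B]]])
    show "\<not> inj_mat (A * B)"
      using not_inj inj_mat_left_factor[OF _ Ac carrier[OF B]] by blast
    show "mat_range (A * B) \<subseteq> mat_range A"
      using Ac carrier[OF B] by (auto simp: mat_range_def)
  qed
  moreover have "A * A = 0\<^sub>m n n" by (rule XA[OF AS(1) A0]) simp
  ultimately show ?thesis
    using has_invariant_subspace_if_annihilated[OF S(1) AS] by blast
qed

section \<open>From a triangularizing chain to an invariant subspace\<close>

lemma right_lincomb_eq:
  assumes b: "\<And>k. k < d \<Longrightarrow> b k \<in> carrier_vec n" and "i < n"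
  shows "right_lincomb n d b c $ i = (\<Sum>k<d. b k $ i * c k)"
proof -
  have "right_lincomb n d b c $ i = (\<Sum>k<d. rsmult_vec (b k) (c k) $ i)"
    unfolding right_lincomb_def using assms by (intro index_finsum_vec) auto
  also have "\<dots> = (\<Sum>k<d. b k $ i * c k)"
    using assms by (intro sum.cong) (metis carrier_vecD index_rsmult_vec lessThan_iff)+
  finally show ?thesis .
qed

lemma right_lincomb_carrier:
  "(\<And>k. k < d \<Longrightarrow> b k \<in> carrier_vec n) \<Longrightarrow> right_lincomb n d b c \<in> carrier_vec n"
  unfolding right_lincomb_def by (intro finsum_vec_closed) auto

lemma triangularizable_invariant_line:
  assumes "triangularizable n S" "2 \<le> n"
  shows "has_invariant_subspace n (S :: 'a::division_ring mat set)"
proof -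
  obtain V :: "nat \<Rightarrow> 'a vec set" where V: "right_subspace n (V 1)" "has_right_dim n (V 1) 1"
    "\<forall>A\<in>S. \<forall>v\<in>V 1. A *\<^sub>v v \<in> V 1"
    using assms unfolding triangularizable_def by (metis One_nat_def Suc_1 Suc_leD)
  then obtain b where b: "right_basis n (V 1) 1 b" by (auto simp: has_right_dim_def)
  have bc: "b k \<in> carrier_vec n" if "k < 1" for k
    using b V(1) that by (auto simp: right_basis_def right_subspace_def)
  have comb: "right_lincomb n 1 b c = rsmult_vec (b 0) (c 0)" for c
    using right_lincomb_eq[where d = 1 and c = c, OF bc] right_lincomb_carrier[where d = 1 and c = c, OF bc]
      bc[of 0]
    by (intro eq_vecI) auto
  have "V 1 \<noteq> {0\<^sub>v n}"
  proof
    assume "V 1 = {0\<^sub>v n}"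
    then have "b 0 = 0\<^sub>v n" using b by (auto simp: right_basis_def)
    then have "right_lincomb n 1 b (\<lambda>_. 1) = 0\<^sub>v n"
      unfolding comb by (intro eq_vecI) auto
    moreover have "c 0 = 0" if "right_lincomb n 1 b c = 0\<^sub>v n" for c
      using b that by (auto simp: right_basis_def)
    ultimately show False by fastforce
  qed
  \<comment> \<open>As \<open>n \<ge> 2\<close>, there are two distinct unit vectors, which cannot
    both be right multiples of \<open>b 0\<close>.\<close>
  moreover have "V 1 \<noteq> carrier_vec n"
  proof
    assume "V 1 = carrier_vec n"
    then have "\<exists>c. v = rsmult_vec (b 0) c" if "v \<in> carrier_vec n" for v
      using b that unfolding right_basis_def comb by blast
    then obtain c d where cd: "unit_vec n 0 = rsmult_vec (b 0) c" "unit_vec n 1 = rsmult_vec (b 0) d"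
      by (meson unit_vec_carrier)
    have "b 0 $ 0 * c = 1" "b 0 $ 1 * c = 0" "b 0 $ 1 * d = 1"
      using arg_cong[OF cd(1), of "\<lambda>v. v $ 0"] arg_cong[OF cd(1), of "\<lambda>v. v $ 1"]
        arg_cong[OF cd(2), of "\<lambda>v. v $ 1"] assms(2) bc[of 0] by auto
    then show False by auto
  qed
  ultimately show ?thesis
    using V unfolding has_invariant_subspace_def by blast
qed

lemma central_plus_nilpotent_has_invariant_subspace:
  assumes S: "mat_semigroup n S" "\<forall>A\<in>S. central_plus_nilpotent_mat n A" and n: "2 \<le> n"
    and unip: "\<forall>U :: 'a::{division_ring, ring_char_0} mat set.
      mat_semigroup n U \<and> (\<forall>A\<in>U. unipotent_mat n A) \<longrightarrow> triangularizable n U"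
  shows "has_invariant_subspace n (S :: 'a mat set)"
proof (cases "\<exists>A\<in>S. A \<noteq> 0\<^sub>m n n \<and> has_eigenvalue n 0 A")
  case True
  then show ?thesis using has_invariant_subspace_if_nilpotent[OF S] n by simp
next
  case False
  have n0: "0 < n" using n by simp
  have carrier: "B \<in> carrier_mat n n" if "B \<in> S" for B
    using S that by (auto simp: mat_semigroup_def)
  have closed: "B * C \<in> S" if "B \<in> S" "C \<in> S" for B C
    using S that by (auto simp: mat_semigroup_def)
  \<comment> \<open>The unipotent factor of a nonzero element of \<open>S\<close> need not lie in
    \<open>S\<close>, but it lies in \<open>T\<close>; closure under products passes from
    \<open>S\<close> to \<open>T\<close> because the scalars are central.\<close>
  define T where "T = {A \<in> carrier_mat n n. \<exists>c. c \<noteq> 0 \<and> scalar_mat n c * A \<in> S}"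
  have T_mult: "A * B \<in> T" if A: "A \<in> T" and B: "B \<in> T" for A B
  proof -
    from A B obtain c d where c: "c \<noteq> 0" "scalar_mat n c * A \<in> S" and d: "d \<noteq> 0" "scalar_mat n d * B \<in> S"
      and AB: "A \<in> carrier_mat n n" "B \<in> carrier_mat n n"
      by (auto simp: T_def)
    have dB: "scalar_mat n d * B \<in> carrier_mat n n"
      by (rule mult_carrier_mat[OF scalar_mat_carrier AB(2)])
    have "scalar_mat n c * A * (scalar_mat n d * B) = scalar_mat n c * (A * scalar_mat n d * B)"
      using assoc_mult_mat[OF scalar_mat_carrier AB(1) dB] assoc_mult_mat[OF AB(1) scalar_mat_carrier AB(2)]
      by simp
    also have "\<dots> = scalar_mat n c * (scalar_mat n d * (A * B))"
      unfolding scalar_mat_commute[OF AB(1)]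
      using assoc_mult_mat[OF scalar_mat_carrier AB] by simp
    also have "\<dots> = scalar_mat n (c * d) * (A * B)"
      unfolding scalar_mat_mult
      by (rule assoc_mult_mat[OF scalar_mat_carrier scalar_mat_carrier mult_carrier_mat[OF AB], symmetric])
    finally have "scalar_mat n (c * d) * (A * B) \<in> S"
      using closed[OF c(2) d(2)] by simp
    then show ?thesis
      using c(1) d(1) AB unfolding T_def by (intro CollectI conjI exI[of _ "c * d"]) auto
  qed
  have T_power: "A ^\<^sub>m k * B \<in> T" if "A \<in> T" "B \<in> T" for A B k
  proof (induction k)
    case 0
    then show ?case using that by (auto simp: T_def)
  next
    case (Suc k)
    have AB: "A \<in> carrier_mat n n" "B \<in> carrier_mat n n" using that by (auto simp: T_def)
    have "A ^\<^sub>m Suc k * B = A * (A ^\<^sub>m k * B)"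
      unfolding pow_mat_Suc_left[OF AB(1)] by (rule assoc_mult_mat[OF AB(1) pow_carrier_mat[OF AB(1)] AB(2)])
    then show ?case using T_mult[OF that(1) Suc] by simp
  qed
  have rescale: "scalar_mat n (inverse c) * (scalar_mat n c * A) = A" if "c \<noteq> 0" "A \<in> carrier_mat n n" for c A
    using assoc_mult_mat[OF scalar_mat_carrier scalar_mat_carrier that(2), of "inverse c" c] that
    by (simp add: scalar_mat_mult[symmetric])
  have S_eig: "\<exists>c. c \<noteq> 0 \<and> has_eigenvalue n c A" if "A \<in> S" "A \<noteq> 0\<^sub>m n n" for A
    using False S(2) that by (metis central_plus_nilpotent_iff)
  \<comment> \<open>Injectivity serves to exclude the zero matrix, which has no nonzero
    eigenvalue.\<close>
  have T_eig: "\<exists>c. c \<noteq> 0 \<and> has_eigenvalue n c A" if A: "A \<in> T" "inj_mat A" for A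
  proof -
    obtain c where c: "c \<noteq> 0" "scalar_mat n c * A \<in> S" and Ac: "A \<in> carrier_mat n n"
      using A by (auto simp: T_def)
    have "A \<noteq> 0\<^sub>m n n" using A(2) zero_mat_not_inj[OF n0] by auto
    then have "scalar_mat n c * A \<noteq> 0\<^sub>m n n"
      using rescale[OF c(1) Ac] right_mult_zero_mat[OF scalar_mat_carrier] by metis
    then obtain e where "e \<noteq> 0" "has_eigenvalue n e (scalar_mat n c * A)"
      using S_eig[OF c(2)] by blast
    then show ?thesis
      using scalar_mat_mult_nilpotent_shift[of n e "scalar_mat n c * A" "inverse c"] rescale[OF c(1) Ac] c(1)
      by (intro exI[of _ "inverse c * e"]) simp
  qed
  define U where "U = {A \<in> T. has_eigenvalue n 1 A}"
  have "mat_semigroup n U"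
    unfolding mat_semigroup_def
  proof (intro conjI ballI)
    fix A B assume "A \<in> U" "B \<in> U"
    then have AB: "A \<in> T" "B \<in> T" "has_eigenvalue n 1 A" "has_eigenvalue n 1 B"
      and c: "A \<in> carrier_mat n n" "B \<in> carrier_mat n n" by (auto simp: U_def T_def)
    have inj: "inj_mat A" "inj_mat B"
      using AB by (auto intro: inj_mat_if_has_eigenvalue)
    have "inj_mat (A ^\<^sub>m k * B)" for k
      by (rule inj_mat_mult[OF inj_mat_power[OF inj(1) c(1)] inj(2) pow_carrier_mat[OF c(1)] c(2)])
    then have "\<exists>e. e \<noteq> 0 \<and> has_eigenvalue n e (A ^\<^sub>m k * B)" for k
      by (rule T_eig[OF T_power[OF AB(1,2)]])
    then have "has_eigenvalue n 1 (A * B)"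
      by (rule unipotent_product_has_eigenvalue_1[OF AB(3,4) n0])
    then show "A * B \<in> U" using T_mult[OF AB(1,2)] by (simp add: U_def)
  qed (auto simp: U_def T_def)
  moreover have "\<forall>A\<in>U. unipotent_mat n A"
    by (auto simp: U_def unipotent_mat_if_has_eigenvalue_1)
  ultimately have "has_invariant_subspace n U"
    using unip triangularizable_invariant_line[OF _ n] by blast
  then obtain V where V: "right_subspace n V" "V \<noteq> {0\<^sub>v n}" "V \<noteq> carrier_vec n"
    and inv: "\<And>A v. A \<in> U \<Longrightarrow> v \<in> V \<Longrightarrow> A *\<^sub>v v \<in> V"
    unfolding has_invariant_subspace_def by blast
  have "A *\<^sub>v v \<in> V" if A: "A \<in> S" and v: "v \<in> V" for A v
  proof (cases "A = 0\<^sub>m n n")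
    case True
    have "v \<in> carrier_vec n" using V(1) v by (auto simp: right_subspace_def)
    then have "A *\<^sub>v v = 0\<^sub>v n" unfolding True by (intro eq_vecI) auto
    then show ?thesis using V(1) by (simp add: right_subspace_def)
  next
    case False
    note Ac = carrier[OF A]
    obtain c where c: "c \<noteq> 0" "has_eigenvalue n c A" using S_eig[OF A False] by blast
    \<comment> \<open>The unipotent factor of \<open>A\<close>. It preserves \<open>V\<close>, and
      so does \<open>A\<close>, since a central scalar acts on vectors as right
      multiplication.\<close>
    define B where "B = scalar_mat n (inverse c) * A"
    have Bc: "B \<in> carrier_mat n n"
      unfolding B_def by (rule mult_carrier_mat[OF scalar_mat_carrier Ac])
    have cB: "scalar_mat n c * B = A"
      using rescale[of "inverse c" A] c(1) Ac by (simp add: B_def)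
    have "has_eigenvalue n 1 B"
      using scalar_mat_mult_nilpotent_shift[OF c(2), of "inverse c"] c(1) by (simp add: B_def)
    then have "B \<in> U" using c(1) cB A Bc by (auto simp: U_def T_def)
    then have Bv: "B *\<^sub>v v \<in> V" using v by (rule inv)
    then have "B *\<^sub>v v \<in> carrier_vec n" "v \<in> carrier_vec n"
      using V(1) v by (auto simp: right_subspace_def)
    then have "A *\<^sub>v v = rsmult_vec (B *\<^sub>v v) (cval c)"
      using assoc_mult_mat_vec[OF scalar_mat_carrier Bc, of v c] scalar_mat_mult_vec[of "B *\<^sub>v v" n c]
      by (simp add: cB)
    then show ?thesis using V(1) Bv by (simp add: right_subspace_def)
  qed
  then show ?thesis using V unfolding has_invariant_subspace_def by blast
qed

section \<open>Simultaneous triangular form\<close>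

text \<open>A change of basis in place of a chain of subspaces: it composes with block
  decompositions, so the induction needs no quotient spaces.\<close>

definition upper_triangularizable :: "nat \<Rightarrow> 'a::division_ring mat set \<Rightarrow> bool" where
  "upper_triangularizable n S \<longleftrightarrow>
     (\<exists>T T'. T \<in> carrier_mat n n \<and> T' \<in> carrier_mat n n \<and> T * T' = 1\<^sub>m n \<and> T' * T = 1\<^sub>m n \<and>
        (\<forall>A\<in>S. upper_triangular (T' * A * T)))"

section \<open>From an upper triangular form to a chain of subspaces\<close>

lemma coord_subspace_right_subspace:
  fixes T :: "'a::division_ring mat"
  assumes T: "T \<in> carrier_mat n n"
  shows "right_subspace n ((*\<^sub>v) T ` coord_subspace n d)"
  unfolding right_subspace_def
proof (intro conjI ballI allI)
  show "(*\<^sub>v) T ` coord_subspace n d \<subseteq> carrier_vec n"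
    using T by (auto simp: coord_subspace_def)
  show "0\<^sub>v n \<in> (*\<^sub>v) T ` coord_subspace n d"
    using mult_mat_zero_vec[OF T] by (intro image_eqI[of _ _ "0\<^sub>v n"]) (auto simp: coord_subspace_def)
next
  fix v w assume "v \<in> (*\<^sub>v) T ` coord_subspace n d" "w \<in> (*\<^sub>v) T ` coord_subspace n d"
  then obtain x y where xy: "x \<in> coord_subspace n d" "y \<in> coord_subspace n d" "v = T *\<^sub>v x" "w = T *\<^sub>v y"
    by blast
  then have "v + w = T *\<^sub>v (x + y)"
    using mult_add_distrib_mat_vec[OF T, of x y] by (auto simp: coord_subspace_def)
  moreover have "x + y \<in> coord_subspace n d"
    using xy by (auto simp: coord_subspace_def)
  ultimately show "v + w \<in> (*\<^sub>v) T ` coord_subspace n d" by blast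
next
  fix v c assume "v \<in> (*\<^sub>v) T ` coord_subspace n d"
  then obtain x where x: "x \<in> coord_subspace n d" "v = T *\<^sub>v x" by blast
  then have "rsmult_vec v c = T *\<^sub>v rsmult_vec x c"
    using mult_mat_rsmult_vec[OF T, of x c] by (auto simp: coord_subspace_def)
  moreover have "rsmult_vec x c \<in> coord_subspace n d"
    using x by (auto simp: coord_subspace_def)
  ultimately show "rsmult_vec v c \<in> (*\<^sub>v) T ` coord_subspace n d" by blast
qed

lemma coord_subspace_has_right_dim:
  fixes T :: "'a::division_ring mat"
  assumes T: "T \<in> carrier_mat n n" and inj: "inj_mat T" and d: "d \<le> n"
  shows "has_right_dim n ((*\<^sub>v) T ` coord_subspace n d) d"
proof -
  let ?x = "\<lambda>c. vec n (\<lambda>i. if i < d then c i else 0)"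
  have col: "col T k \<in> carrier_vec n" for k using T by auto
  have comb: "right_lincomb n d (col T) c = T *\<^sub>v ?x c" for c
  proof (rule eq_vecI)
    fix i assume "i < dim_vec (T *\<^sub>v ?x c)"
    then have i: "i < n" using T by auto
    have "right_lincomb n d (col T) c $ i = (\<Sum>k<d. T $$ (i, k) * c k)"
      unfolding right_lincomb_eq[OF col i] using T i d by (intro sum.cong) auto
    also have "\<dots> = (\<Sum>k\<in>{0..<n}. T $$ (i, k) * ?x c $ k)"
      using d by (intro sum.mono_neutral_cong_left) auto
    also have "\<dots> = (T *\<^sub>v ?x c) $ i"
      using T i by (auto simp: scalar_prod_def)
    finally show "right_lincomb n d (col T) c $ i = (T *\<^sub>v ?x c) $ i" .
  qed (use T right_lincomb_carrier[of d "col T" n c] col in auto)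
  have "right_basis n ((*\<^sub>v) T ` coord_subspace n d) d (col T)"
    unfolding right_basis_def comb
  proof (intro conjI allI impI ballI)
    fix k assume k: "k < d"
    have "T *\<^sub>v unit_vec n k = col T k"
      using T k d by (intro eq_vecI) auto
    moreover have "unit_vec n k \<in> coord_subspace n d"
      using k by (auto simp: coord_subspace_def)
    ultimately show "col T k \<in> (*\<^sub>v) T ` coord_subspace n d" by (metis image_eqI)
  next
    fix c k assume "T *\<^sub>v ?x c = 0\<^sub>v n" "k < d"
    then have "?x c = 0\<^sub>v n" by (intro inj_matD[OF inj T vec_carrier])
    then have "?x c $ k = 0\<^sub>v n $ k" by (rule arg_cong)
    then show "c k = 0" using \<open>k < d\<close> d by simp
  next
    fix v assume "v \<in> (*\<^sub>v) T ` coord_subspace n d"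
    then obtain x where x: "x \<in> coord_subspace n d" "v = T *\<^sub>v x" by blast
    have "?x (($) x) = x"
      using x(1) by (intro eq_vecI) (auto simp: coord_subspace_def)
    then show "\<exists>c. v = T *\<^sub>v ?x c" using x(2) by metis
  qed
  then show ?thesis unfolding has_right_dim_def by blast
qed

lemma conjugate_mult_vec:
  fixes A T T' :: "'a::division_ring mat"
  assumes "A \<in> carrier_mat n n" "T \<in> carrier_mat n n" "T' \<in> carrier_mat n n" "v \<in> carrier_vec n"
  shows "T' * A * T *\<^sub>v v = T' *\<^sub>v (A *\<^sub>v (T *\<^sub>v v))"
  using assoc_mult_mat_vec[OF mult_carrier_mat[OF assms(3,1)] assms(2,4)]
    assoc_mult_mat_vec[OF assms(3,1), of "T *\<^sub>v v"] assms by simp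

lemma triangularizable_if_upper_triangularizable:
  assumes "upper_triangularizable n S" "S \<subseteq> carrier_mat n n"
  shows "triangularizable n (S :: 'a::division_ring mat set)"
proof -
  obtain T T' where T: "T \<in> carrier_mat n n" and T': "T' \<in> carrier_mat n n"
    and inv: "T * T' = 1\<^sub>m n" "T' * T = 1\<^sub>m n"
    and ut: "\<And>A. A \<in> S \<Longrightarrow> upper_triangular (T' * A * T)"
    using assms(1) unfolding upper_triangularizable_def by blast
  have inj: "inj_mat T" by (rule inj_mat_if_left_inverse[OF T T' inv(2)])
  have TT': "T *\<^sub>v (T' *\<^sub>v v) = v" if "v \<in> carrier_vec n" for v
    using assoc_mult_mat_vec[OF T T' that] that by (simp add: inv)
  \<comment> \<open>The span of the first \<open>j\<close> columns of \<open>T\<close>.\<close>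
  let ?V = "\<lambda>j. (*\<^sub>v) T ` coord_subspace n j"
  have coord_0: "coord_subspace n 0 = {0\<^sub>v n :: 'a vec}"
    by (auto simp: coord_subspace_def)
  have coord_n: "coord_subspace n n = (carrier_vec n :: 'a vec set)"
    by (auto simp: coord_subspace_def)
  have V_0: "?V 0 = {0\<^sub>v n}"
    unfolding coord_0 using mult_mat_zero_vec[OF T] by simp
  have V_n: "?V n = carrier_vec n"
    unfolding coord_n using inj_mat_square_surj[OF T inj] T by (simp add: mat_range_def)
  have V_mono: "?V j \<subseteq> ?V (Suc j)" for j
    by (intro image_mono) (auto simp: coord_subspace_def)
  have V_inv: "A *\<^sub>v v \<in> ?V j" if A: "A \<in> S" and v: "v \<in> ?V j" for A v j
  proof -
    have Ac: "A \<in> carrier_mat n n" using A assms(2) by blast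
    obtain x where x: "x \<in> coord_subspace n j" "v = T *\<^sub>v x" using v by blast
    have xc: "x \<in> carrier_vec n" using x(1) by (simp add: coord_subspace_def)
    let ?C = "T' * A * T"
    have C: "?C \<in> carrier_mat n n"
      by (rule mult_carrier_mat[OF mult_carrier_mat[OF T' Ac] T])
    have "(?C *\<^sub>v x) $ i = 0" if i: "i < n" "j \<le> i" for i
    proof -
      have "(?C *\<^sub>v x) $ i = (\<Sum>k\<in>{0..<n}. ?C $$ (i, k) * x $ k)"
        using C xc i(1) unfolding scalar_prod_def by (simp add: scalar_prod_def del: index_mult_mat)
      also have "\<dots> = 0"
      proof (intro sum.neutral ballI)
        fix k assume k: "k \<in> {0..<n}"
        show "?C $$ (i, k) * x $ k = 0"
        proof (cases "k < i")
          case True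
          then have "?C $$ (i, k) = 0"
            using upper_triangularD[OF ut[OF A] True] C i(1) by (metis carrier_matD(1))
          then show ?thesis by simp
        next
          case False
          then have "x $ k = 0" using x(1) k i by (auto simp: coord_subspace_def)
          then show ?thesis by simp
        qed
      qed
      finally show ?thesis .
    qed
    then have "?C *\<^sub>v x \<in> coord_subspace n j"
      using mult_mat_vec_carrier[OF C xc] by (auto simp: coord_subspace_def)
    moreover have "A *\<^sub>v v = T *\<^sub>v (?C *\<^sub>v x)"
      unfolding conjugate_mult_vec[OF Ac T T' xc] x(2)[symmetric]
      using TT' Ac x(2) T xc by simp
    ultimately show ?thesis by blast
  qed
  show ?thesis
    unfolding triangularizable_def
    by (rule exI[of _ ?V], intro conjI allI impI ballI; (rule V_0 V_n V_mono V_inv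
        coord_subspace_right_subspace[OF T] coord_subspace_has_right_dim[OF T inj]; assumption?))
qed

section \<open>Block upper triangular matrices\<close>

lemma block_upper_mult:
  fixes X X' Y Y' Z Z' :: "'a::ring_1 mat"
  assumes "X \<in> carrier_mat d d" "Y \<in> carrier_mat d m" "Z \<in> carrier_mat m m"
    and "X' \<in> carrier_mat d d" "Y' \<in> carrier_mat d m" "Z' \<in> carrier_mat m m"
  shows "four_block_mat X Y (0\<^sub>m m d) Z * four_block_mat X' Y' (0\<^sub>m m d) Z'
    = four_block_mat (X * X') (X * Y' + Y * Z') (0\<^sub>m m d) (Z * Z')"
  by (subst mult_four_block_mat[OF assms(1,2) zero_carrier_mat assms(3-5) zero_carrier_mat assms(6)])
    (use assms in simp)

lemma four_block_mat_eqD: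
  assumes "X \<in> carrier_mat d d" "Y \<in> carrier_mat d m" "W \<in> carrier_mat m d" "Z \<in> carrier_mat m m"
    and "X' \<in> carrier_mat d d" "Y' \<in> carrier_mat d m" "W' \<in> carrier_mat m d" "Z' \<in> carrier_mat m m"
    and eq: "four_block_mat X Y W Z = four_block_mat X' Y' W' Z'"
  shows "X = X'" "Z = Z'"
proof -
  show "X = X'"
  proof (rule eq_matI)
    fix i j assume "i < dim_row X'" "j < dim_col X'"
    then show "X $$ (i, j) = X' $$ (i, j)"
      using arg_cong[OF eq, of "\<lambda>M. M $$ (i, j)"] assms(1-8) by simp
  qed (use assms(1-8) in auto)
  show "Z = Z'"
  proof (rule eq_matI)
    fix i j assume "i < dim_row Z'" "j < dim_col Z'"
    then show "Z $$ (i, j) = Z' $$ (i, j)"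
      using arg_cong[OF eq, of "\<lambda>M. M $$ (i + d, j + d)"] assms(1-8) by simp
  qed (use assms(1-8) in auto)
qed

text \<open>The corner accumulates mixed products and is left existential; nilpotency is read off
  the diagonal blocks.\<close>

lemma block_upper_power:
  fixes X Y Z :: "'a::ring_1 mat"
  assumes "X \<in> carrier_mat d d" "Y \<in> carrier_mat d m" "Z \<in> carrier_mat m m"
  shows "\<exists>W\<in>carrier_mat d m. four_block_mat X Y (0\<^sub>m m d) Z ^\<^sub>m k
    = four_block_mat (X ^\<^sub>m k) W (0\<^sub>m m d) (Z ^\<^sub>m k)"
proof (induction k)
  case 0
  show ?case using assms by (intro bexI[of _ "0\<^sub>m d m"]) auto
next
  case (Suc k)
  then obtain W where W: "W \<in> carrier_mat d m"
    "four_block_mat X Y (0\<^sub>m m d) Z ^\<^sub>m k = four_block_mat (X ^\<^sub>m k) W (0\<^sub>m m d) (Z ^\<^sub>m k)" by blast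
  have Xk: "X ^\<^sub>m k \<in> carrier_mat d d" and Zk: "Z ^\<^sub>m k \<in> carrier_mat m m" using assms by auto
  show ?case
    using block_upper_mult[OF Xk W(1) Zk assms] W(2) mult_carrier_mat[OF Xk assms(2)]
      mult_carrier_mat[OF W(1) assms(3)]
    by (intro bexI[of _ "X ^\<^sub>m k * Y + W * Z"]) simp_all
qed

definition upper_left_block :: "nat \<Rightarrow> 'a mat \<Rightarrow> 'a mat" where
  "upper_left_block d C = mat d d (\<lambda>(i, j). C $$ (i, j))"

definition upper_right_block :: "nat \<Rightarrow> nat \<Rightarrow> 'a mat \<Rightarrow> 'a mat" where
  "upper_right_block d m C = mat d m (\<lambda>(i, j). C $$ (i, j + d))"

definition lower_right_block :: "nat \<Rightarrow> nat \<Rightarrow> 'a mat \<Rightarrow> 'a mat" where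
  "lower_right_block d m C = mat m m (\<lambda>(i, j). C $$ (i + d, j + d))"

lemma block_carriers [simp]:
  "upper_left_block d C \<in> carrier_mat d d" "upper_right_block d m C \<in> carrier_mat d m"
  "lower_right_block d m C \<in> carrier_mat m m"
  by (simp_all add: upper_left_block_def upper_right_block_def lower_right_block_def)

lemma block_upper_split:
  assumes "C \<in> carrier_mat (d + m) (d + m)" "\<And>i j. d \<le> i \<Longrightarrow> i < d + m \<Longrightarrow> j < d \<Longrightarrow> C $$ (i, j) = 0"
  shows "C = four_block_mat (upper_left_block d C) (upper_right_block d m C) (0\<^sub>m m d) (lower_right_block d m C)"
  using assms
  by (intro eq_matI) (auto simp: upper_left_block_def upper_right_block_def lower_right_block_def)

text \<open>Subtracting one central scalar \<open>c\<close> shifts both diagonal blocks, and a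
  vanishing power of the whole matrix has vanishing diagonal blocks.\<close>

lemma central_plus_nilpotent_blocks:
  fixes X Y Z :: "'a::division_ring mat"
  assumes XYZ: "X \<in> carrier_mat d d" "Y \<in> carrier_mat d m" "Z \<in> carrier_mat m m"
    and "central_plus_nilpotent_mat (d + m) (four_block_mat X Y (0\<^sub>m m d) Z)"
  shows "central_plus_nilpotent_mat d X" "central_plus_nilpotent_mat m Z"
proof -
  let ?C = "four_block_mat X Y (0\<^sub>m m d) Z"
  obtain c where c: "(?C - scalar_mat (d + m) c) ^\<^sub>m (d + m) = 0\<^sub>m (d + m) (d + m)"
    using assms(4) by (auto simp: central_plus_nilpotent_iff has_eigenvalue_def)
  let ?X = "X - scalar_mat d c" and ?Z = "Z - scalar_mat m c"
  have X: "?X \<in> carrier_mat d d" and Z: "?Z \<in> carrier_mat m m" using XYZ by auto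
  have "?C - scalar_mat (d + m) c = four_block_mat ?X Y (0\<^sub>m m d) ?Z"
    using XYZ by (intro eq_matI) (auto simp: scalar_mat_def)
  then obtain W where W: "W \<in> carrier_mat d m"
    "four_block_mat (?X ^\<^sub>m (d + m)) W (0\<^sub>m m d) (?Z ^\<^sub>m (d + m)) = 0\<^sub>m (d + m) (d + m)"
    using c block_upper_power[OF X XYZ(2) Z, of "d + m"] by auto
  have "(0\<^sub>m (d + m) (d + m) :: 'a mat) = four_block_mat (0\<^sub>m d d) (0\<^sub>m d m) (0\<^sub>m m d) (0\<^sub>m m m)"
    by (intro eq_matI) auto
  then have "four_block_mat (?X ^\<^sub>m (d + m)) W (0\<^sub>m m d) (?Z ^\<^sub>m (d + m))
      = four_block_mat (0\<^sub>m d d) (0\<^sub>m d m) (0\<^sub>m m d) (0\<^sub>m m m)"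
    using W(2) by simp
  then have "?X ^\<^sub>m (d + m) = 0\<^sub>m d d" "?Z ^\<^sub>m (d + m) = 0\<^sub>m m m"
    using four_block_mat_eqD[OF pow_carrier_mat[OF X] W(1) zero_carrier_mat pow_carrier_mat[OF Z]
        zero_carrier_mat zero_carrier_mat zero_carrier_mat zero_carrier_mat] by blast+
  then show "central_plus_nilpotent_mat d X" "central_plus_nilpotent_mat m Z"
    using XYZ(1,3) has_eigenvalueI unfolding central_plus_nilpotent_iff by blast+
qed

lemma conjugate_mult:
  fixes A B T T' :: "'a::ring_1 mat"
  assumes "A \<in> carrier_mat n n" "B \<in> carrier_mat n n" "T \<in> carrier_mat n n" "T' \<in> carrier_mat n n"
    and "T * T' = 1\<^sub>m n"
  shows "T' * A * T * (T' * B * T) = T' * (A * B) * T"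
proof -
  have c: "T' * A \<in> carrier_mat n n" "B * T \<in> carrier_mat n n" "T' * (B * T) \<in> carrier_mat n n"
    using assms by auto
  have "T' * A * T * (T' * B * T) = T' * A * (T * (T' * (B * T)))"
    unfolding assoc_mult_mat[OF assms(4,2,3)] by (rule assoc_mult_mat[OF c(1) assms(3) c(3)])
  also have "T * (T' * (B * T)) = B * T"
    using assoc_mult_mat[OF assms(3,4) c(2)] left_mult_one_mat[OF c(2)] by (metis assms(5))
  also have "T' * A * (B * T) = T' * (A * B) * T"
    using assoc_mult_mat[OF c(1) assms(2,3)] assoc_mult_mat[OF assms(4,1,2)] by simp
  finally show ?thesis .
qed

lemma conjugate_central_plus_nilpotent:
  fixes A T T' :: "'a::division_ring mat"
  assumes T: "T \<in> carrier_mat n n" "T' \<in> carrier_mat n n" "T * T' = 1\<^sub>m n" "T' * T = 1\<^sub>m n"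
    and A: "central_plus_nilpotent_mat n A"
  shows "central_plus_nilpotent_mat n (T' * A * T)"
proof -
  obtain c where Ac: "A \<in> carrier_mat n n" and nil: "(A - scalar_mat n c) ^\<^sub>m n = 0\<^sub>m n n"
    using A by (auto simp: central_plus_nilpotent_iff has_eigenvalue_def)
  let ?N = "A - scalar_mat n c"
  have N: "?N \<in> carrier_mat n n" using Ac by auto
  have "T' * scalar_mat n c * T = scalar_mat n c"
    unfolding scalar_mat_commute[OF T(2)] assoc_mult_mat[OF scalar_mat_carrier T(2,1)] T(4) by simp
  then have shift: "T' * A * T - scalar_mat n c = T' * ?N * T"
    using mult_minus_distrib_mat[OF T(2) Ac scalar_mat_carrier]
      minus_mult_distrib_mat[OF mult_carrier_mat[OF T(2) Ac] mult_carrier_mat[OF T(2) scalar_mat_carrier] T(1)]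
    by simp
  have pow: "(T' * ?N * T) ^\<^sub>m k = T' * ?N ^\<^sub>m k * T" for k
  proof (induction k)
    case 0
    then show ?case using T N by simp
  next
    case (Suc k)
    then show ?case using conjugate_mult[OF pow_carrier_mat[OF N] N T(1-3)] by simp
  qed
  have "(T' * A * T - scalar_mat n c) ^\<^sub>m n = 0\<^sub>m n n"
    unfolding shift pow nil using T by simp
  then show ?thesis
    unfolding central_plus_nilpotent_iff
    using mult_carrier_mat[OF mult_carrier_mat[OF T(2) Ac] T(1)] has_eigenvalueI by blast
qed

text \<open>After the change of basis \<open>T\<close>, the block diagonal matrix of
  \<open>P\<close> and \<open>Q\<close> triangularizes both diagonal blocks at once; the required
  change of basis is the product of the two.\<close>

lemma upper_triangularizable_blocks:
  fixes S :: "'a::division_ring mat set"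
  assumes T: "T \<in> carrier_mat n n" "T' \<in> carrier_mat n n" "T * T' = 1\<^sub>m n" "T' * T = 1\<^sub>m n"
    and n: "n = d + m" and S: "S \<subseteq> carrier_mat n n"
    and blocks: "\<And>A. A \<in> S \<Longrightarrow> X A \<in> carrier_mat d d" "\<And>A. A \<in> S \<Longrightarrow> Y A \<in> carrier_mat d m"
      "\<And>A. A \<in> S \<Longrightarrow> Z A \<in> carrier_mat m m"
      "\<And>A. A \<in> S \<Longrightarrow> T' * A * T = four_block_mat (X A) (Y A) (0\<^sub>m m d) (Z A)"
    and X: "upper_triangularizable d (X ` S)" and Z: "upper_triangularizable m (Z ` S)"
  shows "upper_triangularizable n S"
proof -
  obtain P P' where P: "P \<in> carrier_mat d d" "P' \<in> carrier_mat d d" "P * P' = 1\<^sub>m d" "P' * P = 1\<^sub>m d"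
    "\<And>A. A \<in> S \<Longrightarrow> upper_triangular (P' * X A * P)"
    using X unfolding upper_triangularizable_def by blast
  obtain Q Q' where Q: "Q \<in> carrier_mat m m" "Q' \<in> carrier_mat m m" "Q * Q' = 1\<^sub>m m" "Q' * Q = 1\<^sub>m m"
    "\<And>A. A \<in> S \<Longrightarrow> upper_triangular (Q' * Z A * Q)"
    using Z unfolding upper_triangularizable_def by blast
  let ?E = "four_block_mat P (0\<^sub>m d m) (0\<^sub>m m d) Q" and ?E' = "four_block_mat P' (0\<^sub>m d m) (0\<^sub>m m d) Q'"
  have E: "?E \<in> carrier_mat n n" "?E' \<in> carrier_mat n n"
    using P Q by (auto simp: n)
  have EE': "?E * ?E' = 1\<^sub>m n" "?E' * ?E = 1\<^sub>m n"
    using block_upper_mult[OF P(1) zero_carrier_mat Q(1) P(2) zero_carrier_mat Q(2)]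
      block_upper_mult[OF P(2) zero_carrier_mat Q(2) P(1) zero_carrier_mat Q(1)] P Q
    by (simp_all add: n)
  have inverse: "A * B * (B' * A') = 1\<^sub>m n"
    if "A \<in> carrier_mat n n" "B \<in> carrier_mat n n" "B' \<in> carrier_mat n n" "A' \<in> carrier_mat n n"
      "B * B' = 1\<^sub>m n" "A * A' = 1\<^sub>m n" for A B A' B' :: "'a mat"
    using assoc_mult_mat[OF that(1,2) mult_carrier_mat[OF that(3,4)]] assoc_mult_mat[OF that(2-4)] that
    by simp
  have ut: "upper_triangular (?E' * T' * A * (T * ?E))" if A: "A \<in> S" for A
  proof -
    have Ac: "A \<in> carrier_mat n n" using A S by blast
    have T'A: "T' * A \<in> carrier_mat n n" by (rule mult_carrier_mat[OF T(2) Ac])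
    note b = blocks[OF A]
    have PX: "P' * X A \<in> carrier_mat d d" "Q' * Z A \<in> carrier_mat m m" "P' * Y A \<in> carrier_mat d m"
      using P Q b by auto
    have "?E' * T' * A * (T * ?E) = ?E' * (T' * A * (T * ?E))"
      unfolding assoc_mult_mat[OF E(2) T(2) Ac]
      by (rule assoc_mult_mat[OF E(2) T'A mult_carrier_mat[OF T(1) E(1)]])
    also have "T' * A * (T * ?E) = T' * A * T * ?E"
      by (rule assoc_mult_mat[OF T'A T(1) E(1), symmetric])
    also have "?E' * (T' * A * T * ?E) = ?E' * (T' * A * T) * ?E"
      by (rule assoc_mult_mat[OF E(2) mult_carrier_mat[OF T'A T(1)] E(1), symmetric])
    also have "?E' * (T' * A * T) = four_block_mat (P' * X A) (P' * Y A + 0\<^sub>m d m * Z A) (0\<^sub>m m d) (Q' * Z A)"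
      unfolding b(4) by (rule block_upper_mult[OF P(2) zero_carrier_mat Q(2) b(1-3)])
    also have "\<dots> * ?E = four_block_mat (P' * X A * P)
        (P' * X A * 0\<^sub>m d m + (P' * Y A + 0\<^sub>m d m * Z A) * Q) (0\<^sub>m m d) (Q' * Z A * Q)"
      using b(3) by (intro block_upper_mult PX P(1) Q(1) zero_carrier_mat add_carrier_mat) auto
    finally show ?thesis
      using upper_triangular_four_block[OF mult_carrier_mat[OF PX(1) P(1)] mult_carrier_mat[OF PX(2) Q(1)]
          P(5)[OF A] Q(5)[OF A]] by simp
  qed
  show ?thesis
    unfolding upper_triangularizable_def
    by (rule exI[of _ "T * ?E"], rule exI[of _ "?E' * T'"], intro conjI ballI)
      (rule mult_carrier_mat[OF T(1) E(1)] mult_carrier_mat[OF E(2) T(2)] ut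
        inverse[OF T(1) E(1,2) T(2) EE'(1) T(3)] inverse[OF E(2) T(2,1) E(1) T(4) EE'(2)]; assumption?)+
qed

text \<open>The unipotent hypothesis is needed at all sizes because the induction passes to the
  diagonal blocks, which form semigroups of the same kind of smaller size.\<close>

lemma central_plus_nilpotent_upper_triangularizable:
  fixes S :: "'a::{division_ring, ring_char_0} mat set"
  assumes unip: "\<forall>n. \<forall>S :: 'a mat set.
      mat_semigroup n S \<and> (\<forall>A\<in>S. unipotent_mat n A) \<longrightarrow> triangularizable n S"
    and "mat_semigroup n S" "\<forall>A\<in>S. central_plus_nilpotent_mat n A"
  shows "upper_triangularizable n S"
  using assms(2,3)
proof (induction n arbitrary: S rule: less_induct)
  case (less n)
  have S: "S \<subseteq> carrier_mat n n" and closed: "\<And>A B. A \<in> S \<Longrightarrow> B \<in> S \<Longrightarrow> A * B \<in> S"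
    using less.prems(1) by (auto simp: mat_semigroup_def)
  show ?case
  proof (cases "2 \<le> n")
    case False
    \<comment> \<open>Matrices of size at most one are upper triangular as they stand.\<close>
    have "upper_triangular (1\<^sub>m n * A * 1\<^sub>m n)" if "A \<in> S" for A
      using S that False by (intro upper_triangularI) auto
    then show ?thesis
      unfolding upper_triangularizable_def by (intro exI[of _ "1\<^sub>m n"]) auto
  next
    case True
    have "has_invariant_subspace n S"
      using central_plus_nilpotent_has_invariant_subspace[OF less.prems True] unip by blast
    then obtain V where V: "right_subspace n V" "V \<noteq> {0\<^sub>v n}" "V \<noteq> carrier_vec n"
      and inv: "\<And>A v. A \<in> S \<Longrightarrow> v \<in> V \<Longrightarrow> A *\<^sub>v v \<in> V"
      unfolding has_invariant_subspace_def by blast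
    define d where "d = sdim n V"
    obtain T T' where T: "T \<in> carrier_mat n n" "T' \<in> carrier_mat n n" "T * T' = 1\<^sub>m n" "T' * T = 1\<^sub>m n"
      and VT: "V = (*\<^sub>v) T ` coord_subspace n d"
      using right_subspace_coordinates[OF V(1)] unfolding d_def .
    have "d \<noteq> 0"
    proof
      assume "d = 0"
      then have "coord_subspace n d = {0\<^sub>v n :: 'a vec}" by (auto simp: coord_subspace_def)
      then show False using VT V(2) mult_mat_zero_vec[OF T(1)] by simp
    qed
    moreover have "d \<noteq> n"
    proof
      assume "d = n"
      then have "coord_subspace n d = (carrier_vec n :: 'a vec set)" by (auto simp: coord_subspace_def)
      then show False
        using VT V(3) T(1) inj_mat_square_surj[OF T(1) inj_mat_if_left_inverse[OF T(1,2,4)]]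
        by (simp add: mat_range_def)
    qed
    moreover have "d \<le> n" unfolding d_def by (rule sdim_le[OF V(1)])
    ultimately obtain m where n: "n = d + m" and dm: "d < n" "m < n"
      by (metis le_add_diff_inverse add_less_same_cancel1 add_less_same_cancel2 gr0I le_neq_implies_less less_add_same_cancel1 less_add_same_cancel2)
    let ?C = "\<lambda>A. T' * A * T"
    let ?X = "\<lambda>A. upper_left_block d (?C A)" and ?Y = "\<lambda>A. upper_right_block d m (?C A)"
      and ?Z = "\<lambda>A. lower_right_block d m (?C A)"
    have C: "?C A \<in> carrier_mat (d + m) (d + m)" if "A \<in> S" for A
      using S that T unfolding n by (meson mult_carrier_mat subsetD)
    have block: "?C A = four_block_mat (?X A) (?Y A) (0\<^sub>m m d) (?Z A)" if A: "A \<in> S" for A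
    proof (rule block_upper_split[OF C[OF A]])
      fix i j assume ij: "d \<le> i" "i < d + m" "j < d"
      have Ac: "A \<in> carrier_mat n n" using A S by blast
      \<comment> \<open>Column \<open>j\<close> of \<open>?C A\<close> lists the coordinates of
        \<open>A\<close> applied to the \<open>j\<close>-th basis vector, which lies in
        \<open>V\<close> for \<open>j < d\<close>; by invariance, those from index \<open>d\<close>
        on vanish.\<close>
      have e: "unit_vec n j \<in> coord_subspace n d" using ij by (auto simp: coord_subspace_def)
      then have "A *\<^sub>v (T *\<^sub>v unit_vec n j) \<in> V" using inv[OF A] VT by blast
      then obtain w where w: "w \<in> coord_subspace n d" "A *\<^sub>v (T *\<^sub>v unit_vec n j) = T *\<^sub>v w"
        using VT by blast
      then have wc: "w \<in> carrier_vec n" by (simp add: coord_subspace_def)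
      have "?C A *\<^sub>v unit_vec n j = T' *\<^sub>v (T *\<^sub>v w)"
        unfolding conjugate_mult_vec[OF Ac T(1,2) unit_vec_carrier] w(2) ..
      also have "\<dots> = w"
        using assoc_mult_mat_vec[OF T(2,1) wc] wc by (simp add: T(4))
      finally have "(?C A *\<^sub>v unit_vec n j) $ i = 0"
        using w(1) ij by (simp add: coord_subspace_def n)
      moreover have "(?C A *\<^sub>v unit_vec n j) $ i = ?C A $$ (i, j)"
        using C[OF A] ij by (simp add: n del: index_mult_mat)
      ultimately show "?C A $$ (i, j) = 0" by simp
    qed
    have mult: "?X A * ?X B = ?X (A * B)" "?Z A * ?Z B = ?Z (A * B)" if A: "A \<in> S" and B: "B \<in> S" for A B
    proof -
      have "four_block_mat (?X A * ?X B) (?X A * ?Y B + ?Y A * ?Z B) (0\<^sub>m m d) (?Z A * ?Z B)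
          = four_block_mat (?X A) (?Y A) (0\<^sub>m m d) (?Z A) * four_block_mat (?X B) (?Y B) (0\<^sub>m m d) (?Z B)"
        by (rule block_upper_mult[OF block_carriers block_carriers, symmetric])
      also have "\<dots> = ?C A * ?C B"
        by (rule arg_cong2[where f = "(*)", OF block[OF A, symmetric] block[OF B, symmetric]])
      also have "\<dots> = ?C (A * B)"
        using S A B by (intro conjugate_mult[OF _ _ T(1-3)]) auto
      also have "\<dots> = four_block_mat (?X (A * B)) (?Y (A * B)) (0\<^sub>m m d) (?Z (A * B))"
        by (rule block[OF closed[OF A B]])
      finally have eq: "four_block_mat (?X A * ?X B) (?X A * ?Y B + ?Y A * ?Z B) (0\<^sub>m m d) (?Z A * ?Z B)
          = four_block_mat (?X (A * B)) (?Y (A * B)) (0\<^sub>m m d) (?Z (A * B))" .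
      show "?X A * ?X B = ?X (A * B)" "?Z A * ?Z B = ?Z (A * B)"
        by (rule four_block_mat_eqD[OF mult_carrier_mat[OF block_carriers(1) block_carriers(1)]
              add_carrier_mat[OF mult_carrier_mat[OF block_carriers(2) block_carriers(3)]] zero_carrier_mat
              mult_carrier_mat[OF block_carriers(3) block_carriers(3)]
              block_carriers(1,2) zero_carrier_mat block_carriers(3) eq])+
    qed
    have cpn: "central_plus_nilpotent_mat d (?X A)" "central_plus_nilpotent_mat m (?Z A)" if A: "A \<in> S" for A
    proof -
      have "central_plus_nilpotent_mat n (?C A)"
        using conjugate_central_plus_nilpotent[OF T] less.prems(2) A by blast
      then have "central_plus_nilpotent_mat (d + m) (four_block_mat (?X A) (?Y A) (0\<^sub>m m d) (?Z A))"
        unfolding n arg_cong[where f = "central_plus_nilpotent_mat (d + m)", OF block[OF A], symmetric] .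
      then show "central_plus_nilpotent_mat d (?X A)" "central_plus_nilpotent_mat m (?Z A)"
        using central_plus_nilpotent_blocks[OF block_carriers] by blast+
    qed
    have "upper_triangularizable d (?X ` S)"
      using mult cpn closed by (intro less.IH[OF dm(1)]) (auto simp: mat_semigroup_def)
    moreover have "upper_triangularizable m (?Z ` S)"
      using mult cpn closed by (intro less.IH[OF dm(2)]) (auto simp: mat_semigroup_def)
    ultimately show ?thesis
      using upper_triangularizable_blocks[OF T n S block_carriers block] by blast
  qed
qed

theorem theorem2p2:
  assumes "\<forall>n. \<forall>S :: 'a::{division_ring, ring_char_0} mat set.
      mat_semigroup n S \<and> (\<forall>A\<in>S. unipotent_mat n A) \<longrightarrow> triangularizable n S"
  shows "\<forall>n. \<forall>S :: 'a mat set.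
      mat_semigroup n S \<and> (\<forall>A\<in>S. central_plus_nilpotent_mat n A) \<longrightarrow> triangularizable n S"
  using central_plus_nilpotent_upper_triangularizable[OF assms] triangularizable_if_upper_triangularizable
  by (auto simp: mat_semigroup_def)

end
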